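(* Let $(N(j),g)$ be a 2-step nilpotent Lie group with left-invariant metric, determined by a linear map $j:\mathfrak z\to\mathfrak{so}(\mathfrak v)$, such that $J=C\cdot\mathrm{Id}_{\mathfrak v}$ and $B=D\cdot\mathrm{Id}_{\mathfrak z}$ with $C,D\in\mathbb R$ and $D\neq 2C$. If $T$ is a naturally reductive homogeneous structure on $(N(j),g)$, then it is the unique one, and it is given, for $X,Y\in\mathfrak n=\mathfrak v\oplus\mathfrak z$ (left-invariant vector fields), by $$T_XY=-\tfrac12 j_{Y^{\mathfrak z}}X^{\mathfrak v}+\tfrac12 j_{X^{\mathfrak z}}Y^{\mathfrak v}+\tfrac12[X^{\mathfrak v},Y^{\mathfrak v}]+\tilde T_{X^{\mathfrak z}}Y^{\mathfrak z},$$ where $\tilde T:\mathfrak z\times\mathfrak z\to\mathfrak z$ is a Lie bracket on $\mathfrak z$ such that $\tilde T_{X^{\mathfrak z}}\in\mathfrak{so}(\mathfrak z)$ and $$j_{X^{\mathfrak z}}j_{Y^{\mathfrak z}}Z^{\mathfrak v}-j_{Y^{\mathfrak z}}j_{X^{\mathfrak z}}Z^{\mathfrak v}=j_{\tilde T_{X^{\mathfrak z}}Y^{\mathfrak z}}Z^{\mathfrak v}$$ for all $X,Y,Z\in\mathfrak n$.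
   Context: Setting: $\mathfrak v,\mathfrak z$ are nonzero finite-dimensional real vector spaces, $\mathfrak n=\mathfrak v\oplus\mathfrak z$ carries an inner product $g$ with $\mathfrak v\perp\mathfrak z$, and each $X\in\mathfrak n$ is written $X=X^{\mathfrak v}+X^{\mathfrak z}$. Given a linear map $j:\mathfrak z\to\mathfrak{so}(\mathfrak v)$, $Z\mapsto j_Z$, the Lie bracket on $\mathfrak n$ is defined by $[\mathfrak n,\mathfrak z]=0$, $[\mathfrak v,\mathfrak v]\subseteq\mathfrak z$ and $g([X^{\mathfrak v},Y^{\mathfrak v}],Z^{\mathfrak z})=g(j_{Z^{\mathfrak z}}X^{\mathfrak v},Y^{\mathfrak v})$. $N(j)$ is the simply connected Lie group with this Lie algebra, with the left-invariant Riemannian metric (also denoted $g$) induced by $g$. For orthonormal bases $\{v_i\}$ of $\mathfrak v$ and $\{z_k\}$ of $\mathfrak z$, define $J:\mathfrak v\to\mathfrak v$, $J(X^{\mathfrak v})=\sum_k j_{z_k}j_{z_k}X^{\mathfrak v}$, and $B:\mathfrak z\to\mathfrak z$, $B(X^{\mathfrak z})=\sum_i[v_i,j_{X^{\mathfrak z}}v_i]$. For a Riemannian manifold $(M,g)$ let $\nabla$ be the Levi-Civita connection and $R(X,Y)=[\nabla_X,\nabla_Y]-\nabla_{[X,Y]}$. A homogeneous structure on $(M,g)$ is a $(2,1)$-tensor field $T$, $(X,Y)\mapsto T_XY$, such that for all vector fields $V,X,Y,Z$: (1) $(\nabla_V R)(X,Y)Z=T_V(R(X,Y)Z)-R(T_VX,Y)Z-R(X,T_VY)Z-R(X,Y)(T_VZ)$;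 (2) $(\nabla_XT)_Y=[T_X,T_Y]-T_{T_XY}$; (3) $g(T_XY,Z)+g(Y,T_XZ)=0$. Equivalently, $R$, $T$, $g$ are parallel with respect to $\tilde\nabla=\nabla-T$. It is naturally reductive if moreover $T_XX=0$ for every vector field $X$. *)

theory Defs
  imports "HOL-Analysis.Analysis"
begin

section \<open>Smooth maps and tensor fields on a Euclidean space\<close>

text \<open>
  A simply connected nilpotent Lie group is diffeomorphic to its Lie algebra, so all manifolds
  below are (as manifolds) a Euclidean space with its standard global chart; a tangent vector
  at a point is an element of the same space. The Riemannian metric is an arbitrary
  point-dependent bilinear form \<open>g\<close>, unrelated to the inner product of the chart.
\<close>

text \<open>The space is finite-dimensional, so iterated directional derivatives characterise \<open>C\<^sup>k\<close>.\<close>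

primrec Ck :: "nat \<Rightarrow> ('a::euclidean_space \<Rightarrow> 'b::real_normed_vector) \<Rightarrow> bool" where
  "Ck 0 f \<longleftrightarrow> continuous_on UNIV f"
| "Ck (Suc k) f \<longleftrightarrow> (\<forall>x. f differentiable (at x)) \<and>
                   (\<forall>h. Ck k (\<lambda>x. frechet_derivative f (at x) h))"

definition smooth :: "('a::euclidean_space \<Rightarrow> 'b::real_normed_vector) \<Rightarrow> bool" where
  "smooth f \<longleftrightarrow> (\<forall>k. Ck k f)"

type_synonym 'a vfield = "'a \<Rightarrow> 'a"
type_synonym 'a metric_field = "'a \<Rightarrow> 'a \<Rightarrow> 'a \<Rightarrow> real"
type_synonym 'a tensor21 = "'a \<Rightarrow> 'a \<Rightarrow> 'a \<Rightarrow> 'a"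

definition dir_deriv ::
  "'a vfield \<Rightarrow> ('a::euclidean_space \<Rightarrow> 'b::real_normed_vector) \<Rightarrow> 'a \<Rightarrow> 'b" where
  "dir_deriv X f p = frechet_derivative f (at p) (X p)"

definition vf_bracket :: "'a vfield \<Rightarrow> 'a vfield \<Rightarrow> 'a::euclidean_space vfield" where
  "vf_bracket X Y p = dir_deriv X Y p - dir_deriv Y X p"

definition tensor21_field :: "'a::euclidean_space tensor21 \<Rightarrow> bool" where
  "tensor21_field T \<longleftrightarrow> (\<forall>p. bilinear (T p)) \<and> (\<forall>u w. smooth (\<lambda>p. T p u w))"

definition tact :: "'a tensor21 \<Rightarrow> 'a vfield \<Rightarrow> 'a vfield \<Rightarrow> 'a vfield" where
  "tact T X Y p = T p (X p) (Y p)"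

section \<open>Levi-Civita connection, curvature, homogeneous structures\<close>

definition affine_connection ::
  "('a vfield \<Rightarrow> 'a vfield \<Rightarrow> 'a::euclidean_space vfield) \<Rightarrow> bool" where
  "affine_connection nab \<longleftrightarrow>
     (\<forall>X Y. smooth X \<longrightarrow> smooth Y \<longrightarrow> smooth (nab X Y)) \<and>
     (\<forall>X X' Y p. smooth X \<longrightarrow> smooth X' \<longrightarrow> smooth Y \<longrightarrow>
        nab (\<lambda>q. X q + X' q) Y p = nab X Y p + nab X' Y p) \<and>
     (\<forall>f X Y p. smooth f \<longrightarrow> smooth X \<longrightarrow> smooth Y \<longrightarrow>
        nab (\<lambda>q. f q *\<^sub>R X q) Y p = f p *\<^sub>R nab X Y p) \<and>
     (\<forall>X Y Y' p. smooth X \<longrightarrow> smooth Y \<longrightarrow> smooth Y' \<longrightarrow>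
        nab X (\<lambda>q. Y q + Y' q) p = nab X Y p + nab X Y' p) \<and>
     (\<forall>f X Y p. smooth f \<longrightarrow> smooth X \<longrightarrow> smooth Y \<longrightarrow>
        nab X (\<lambda>q. f q *\<^sub>R Y q) p = dir_deriv X f p *\<^sub>R Y p + f p *\<^sub>R nab X Y p)"

definition levi_civita ::
  "'a metric_field \<Rightarrow> ('a vfield \<Rightarrow> 'a vfield \<Rightarrow> 'a::euclidean_space vfield) \<Rightarrow> bool" where
  "levi_civita g nab \<longleftrightarrow> affine_connection nab \<and>
     (\<forall>X Y Z p. smooth X \<longrightarrow> smooth Y \<longrightarrow> smooth Z \<longrightarrow>
        dir_deriv X (\<lambda>q. g q (Y q) (Z q)) p = g p (nab X Y p) (Z p) + g p (Y p) (nab X Z p)) \<and>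
     (\<forall>X Y p. smooth X \<longrightarrow> smooth Y \<longrightarrow> nab X Y p - nab Y X p = vf_bracket X Y p)"

definition curvature ::
  "('a vfield \<Rightarrow> 'a vfield \<Rightarrow> 'a::euclidean_space vfield) \<Rightarrow>
   'a vfield \<Rightarrow> 'a vfield \<Rightarrow> 'a vfield \<Rightarrow> 'a vfield" where
  "curvature nab X Y Z p =
     nab X (nab Y Z) p - nab Y (nab X Z) p - nab (vf_bracket X Y) Z p"

definition nabla_curvature ::
  "('a vfield \<Rightarrow> 'a vfield \<Rightarrow> 'a::euclidean_space vfield) \<Rightarrow>
   'a vfield \<Rightarrow> 'a vfield \<Rightarrow> 'a vfield \<Rightarrow> 'a vfield \<Rightarrow> 'a vfield" where
  "nabla_curvature nab V X Y Z p =
     nab V (curvature nab X Y Z) p - curvature nab (nab V X) Y Z p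
       - curvature nab X (nab V Y) Z p - curvature nab X Y (nab V Z) p"

definition nabla_tensor ::
  "('a vfield \<Rightarrow> 'a vfield \<Rightarrow> 'a::euclidean_space vfield) \<Rightarrow> 'a tensor21 \<Rightarrow>
   'a vfield \<Rightarrow> 'a vfield \<Rightarrow> 'a vfield \<Rightarrow> 'a vfield" where
  "nabla_tensor nab T X Y Z p =
     nab X (tact T Y Z) p - tact T (nab X Y) Z p - tact T Y (nab X Z) p"

definition homogeneous_structure ::
  "'a metric_field \<Rightarrow> ('a vfield \<Rightarrow> 'a vfield \<Rightarrow> 'a::euclidean_space vfield) \<Rightarrow>
   'a tensor21 \<Rightarrow> bool" where
  "homogeneous_structure g nab T \<longleftrightarrow> tensor21_field T \<and>
     (\<forall>V X Y Z p. smooth V \<longrightarrow> smooth X \<longrightarrow> smooth Y \<longrightarrow> smooth Z \<longrightarrow>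
        nabla_curvature nab V X Y Z p =
          tact T V (curvature nab X Y Z) p - curvature nab (tact T V X) Y Z p
            - curvature nab X (tact T V Y) Z p - curvature nab X Y (tact T V Z) p) \<and>
     (\<forall>X Y Z p. smooth X \<longrightarrow> smooth Y \<longrightarrow> smooth Z \<longrightarrow>
        nabla_tensor nab T X Y Z p =
          tact T X (tact T Y Z) p - tact T Y (tact T X Z) p - tact T (tact T X Y) Z p) \<and>
     (\<forall>X Y Z p. smooth X \<longrightarrow> smooth Y \<longrightarrow> smooth Z \<longrightarrow>
        g p (tact T X Y p) (Z p) + g p (Y p) (tact T X Z p) = 0)"

definition naturally_reductive ::
  "'a metric_field \<Rightarrow> ('a vfield \<Rightarrow> 'a vfield \<Rightarrow> 'a::euclidean_space vfield) \<Rightarrow>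
   'a tensor21 \<Rightarrow> bool" where
  "naturally_reductive g nab T \<longleftrightarrow> homogeneous_structure g nab T \<and>
     (\<forall>X p. smooth X \<longrightarrow> tact T X X p = 0)"

section \<open>The Lie group \<open>N(j)\<close> with its left-invariant metric\<close>

text \<open>
  The space \<open>\<nn> = \<vv> \<oplus> \<zz>\<close> is the product type \<open>'v \<times> 'z\<close> with its product inner product; this
  makes the two factors orthogonal. Euclidean spaces have positive dimension.
\<close>

definition so :: "('a::real_inner \<Rightarrow> 'a) set" where
  "so = {A. linear A \<and> (\<forall>x y. A x \<bullet> y = - (x \<bullet> A y))}"

definition lie_bracket :: "('a::real_vector \<Rightarrow> 'a \<Rightarrow> 'a) \<Rightarrow> bool" where
  "lie_bracket b \<longleftrightarrow> bilinear b \<and> (\<forall>x. b x x = 0) \<and>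
     (\<forall>x y z. b x (b y z) + b y (b z x) + b z (b x y) = 0)"

definition v_bracket ::
  "('z::euclidean_space \<Rightarrow> 'v::euclidean_space \<Rightarrow> 'v) \<Rightarrow> 'v \<Rightarrow> 'v \<Rightarrow> 'z" where
  "v_bracket j x y = (THE w. \<forall>z. w \<bullet> z = j z x \<bullet> y)"

definition n_bracket ::
  "('z::euclidean_space \<Rightarrow> 'v::euclidean_space \<Rightarrow> 'v) \<Rightarrow> 'v \<times> 'z \<Rightarrow> 'v \<times> 'z \<Rightarrow> 'v \<times> 'z" where
  "n_bracket j X Y = (0, v_bracket j (fst X) (fst Y))"

text \<open>
  \<open>Basis\<close> is one orthonormal basis; both operators below are traces and do not depend on it.
\<close>

definition J_op :: "('z::euclidean_space \<Rightarrow> 'v::euclidean_space \<Rightarrow> 'v) \<Rightarrow> 'v \<Rightarrow> 'v" where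
  "J_op j x = (\<Sum>z\<in>Basis. j z (j z x))"

definition B_op :: "('z::euclidean_space \<Rightarrow> 'v::euclidean_space \<Rightarrow> 'v) \<Rightarrow> 'z \<Rightarrow> 'z" where
  "B_op j z = (\<Sum>v\<in>Basis. v_bracket j v (j z v))"

text \<open>
  The group \<open>N(j)\<close> in exponential coordinates: by the Baker-Campbell-Hausdorff formula, which
  stops after the first bracket for a 2-step nilpotent Lie algebra. The neutral element is \<open>0\<close>
  and the inverse of \<open>p\<close> is \<open>-p\<close>.
\<close>

definition n_mult ::
  "('z::euclidean_space \<Rightarrow> 'v::euclidean_space \<Rightarrow> 'v) \<Rightarrow> 'v \<times> 'z \<Rightarrow> 'v \<times> 'z \<Rightarrow> 'v \<times> 'z" where
  "n_mult j p q = p + q + (1/2) *\<^sub>R n_bracket j p q"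

definition left_inv_field ::
  "('z::euclidean_space \<Rightarrow> 'v::euclidean_space \<Rightarrow> 'v) \<Rightarrow> 'v \<times> 'z \<Rightarrow> ('v \<times> 'z) vfield" where
  "left_inv_field j X p = frechet_derivative (n_mult j p) (at 0) X"

definition left_inv_metric ::
  "('z::euclidean_space \<Rightarrow> 'v::euclidean_space \<Rightarrow> 'v) \<Rightarrow> ('v \<times> 'z) metric_field" where
  "left_inv_metric j p u w =
     frechet_derivative (n_mult j (- p)) (at p) u \<bullet> frechet_derivative (n_mult j (- p)) (at p) w"

section \<open>Consistency of the definitions\<close>

lemma v_bracket_sum:
  fixes j :: "'z::euclidean_space \<Rightarrow> 'v::euclidean_space \<Rightarrow> 'v"
  assumes "bilinear j"
  shows "v_bracket j x y = (\<Sum>z\<in>Basis. (j z x \<bullet> y) *\<^sub>R z)"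
    and v_bracket_inner: "v_bracket j x y \<bullet> z = j z x \<bullet> y"
proof -
  have lin: "linear (\<lambda>z. j z x \<bullet> y)"
    using assms by (auto intro!: linearI simp: bilinear_ladd bilinear_lmul inner_add_left)
  have w: "(\<Sum>z\<in>Basis. (j z x \<bullet> y) *\<^sub>R z) \<bullet> z' = j z' x \<bullet> y" for z'
  proof -
    have "j z' x \<bullet> y = (\<lambda>z. j z x \<bullet> y) (\<Sum>b\<in>Basis. (z' \<bullet> b) *\<^sub>R b)"
      by (simp add: euclidean_representation)
    also have "\<dots> = (\<Sum>b\<in>Basis. (z' \<bullet> b) *\<^sub>R (j b x \<bullet> y))"
      by (subst linear_sum[OF lin]) (simp add: linear_cmul[OF lin])
    also have "\<dots> = (\<Sum>b\<in>Basis. (j b x \<bullet> y) *\<^sub>R b) \<bullet> z'"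
      unfolding inner_sum_left inner_scaleR_left by (simp add: inner_commute mult.commute)
    finally show ?thesis ..
  qed
  show eq: "v_bracket j x y = (\<Sum>z\<in>Basis. (j z x \<bullet> y) *\<^sub>R z)" unfolding v_bracket_def
  proof (rule the_equality)
    show "\<forall>z. (\<Sum>z\<in>Basis. (j z x \<bullet> y) *\<^sub>R z) \<bullet> z = j z x \<bullet> y" using w by simp
  next
    fix u assume "\<forall>z. u \<bullet> z = j z x \<bullet> y"
    then have "u \<bullet> z = (\<Sum>z\<in>Basis. (j z x \<bullet> y) *\<^sub>R z) \<bullet> z" for z using w by simp
    then show "u = (\<Sum>z\<in>Basis. (j z x \<bullet> y) *\<^sub>R z)" by (rule euclidean_eqI)
  qed
  show "v_bracket j x y \<bullet> z = j z x \<bullet> y" unfolding eq by (rule w)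
qed

locale two_step =
  fixes j :: "'z::euclidean_space \<Rightarrow> 'v::euclidean_space \<Rightarrow> 'v"
  assumes bil: "bilinear j" and skew: "\<And>z. j z \<in> so"
begin

lemma j_skew: "j z x \<bullet> y = - (x \<bullet> j z y)"
  using skew[of z] by (auto simp: so_def)

lemma v_bracket_bilinear: "bilinear (v_bracket j)"
  unfolding bilinear_def
  by (intro conjI allI linearI)
     (auto simp: v_bracket_sum[OF bil] bilinear_radd[OF bil] bilinear_rmul[OF bil]
        inner_add_left inner_add_right scaleR_add_left sum.distrib scaleR_sum_right)

lemma v_bracket_antisym: "v_bracket j y x = - v_bracket j x y"
proof -
  have "j z y \<bullet> x = - (j z x \<bullet> y)" for z
    using j_skew[of z y x] by (simp add: inner_commute)
  then show ?thesis by (simp add: v_bracket_sum[OF bil] sum_negf)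
qed

lemma v_bracket_self: "v_bracket j x x = 0"
proof -
  have "j z x \<bullet> x = 0" for z
    using j_skew[of z x x] by (simp add: inner_commute)
  then show ?thesis by (simp add: v_bracket_sum[OF bil])
qed

lemmas vb_simps =
  bilinear_ladd[OF v_bracket_bilinear] bilinear_radd[OF v_bracket_bilinear]
  bilinear_lmul[OF v_bracket_bilinear] bilinear_rmul[OF v_bracket_bilinear]
  bilinear_lneg[OF v_bracket_bilinear] bilinear_rneg[OF v_bracket_bilinear]
  bilinear_lzero[OF v_bracket_bilinear] bilinear_rzero[OF v_bracket_bilinear]
  v_bracket_self

lemma n_bracket_bilinear: "bilinear (n_bracket j)"
  unfolding bilinear_def
  by (intro conjI allI linearI) (auto simp: n_bracket_def vb_simps)

lemma n_bracket_lie: "lie_bracket (n_bracket j)"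
  unfolding lie_bracket_def
  using n_bracket_bilinear by (auto simp: n_bracket_def vb_simps zero_prod_def)

lemma n_mult_group:
  "n_mult j (n_mult j p q) r = n_mult j p (n_mult j q r)"
  "n_mult j 0 p = p" "n_mult j p 0 = p"
  "n_mult j (- p) p = 0" "n_mult j p (- p) = 0"
  by (simp_all add: n_mult_def n_bracket_def prod_eq_iff vb_simps scaleR_add_right)

lemma n_mult_has_derivative:
  "(n_mult j p has_derivative (\<lambda>X. X + (1/2) *\<^sub>R n_bracket j p X)) (at q)"
proof -
  have "bounded_linear (n_bracket j p)"
    using n_bracket_bilinear unfolding bilinear_def linear_conv_bounded_linear by blast
  then have *: "(n_bracket j p has_derivative n_bracket j p) (at q)"
    by (rule bounded_linear_imp_has_derivative)
  have "((\<lambda>q. p + q + (1/2) *\<^sub>R n_bracket j p q) has_derivative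
      (\<lambda>X. 0 + X + (1/2) *\<^sub>R n_bracket j p X)) (at q)"
    by (intro has_derivative_add has_derivative_const has_derivative_ident
        has_derivative_scaleR_right *)
  then show ?thesis unfolding n_mult_def[abs_def] by (simp only: add_0)
qed

lemma n_mult_frechet:
  "frechet_derivative (n_mult j p) (at q) = (\<lambda>X. X + (1/2) *\<^sub>R n_bracket j p X)"
  by (rule frechet_derivative_at[OF n_mult_has_derivative, symmetric])

lemma left_inv_field_eq: "left_inv_field j X p = X + (1/2) *\<^sub>R n_bracket j p X"
  by (simp add: left_inv_field_def n_mult_frechet)

lemma left_inv_metric_eq:
  "left_inv_metric j p u w =
     (u - (1/2) *\<^sub>R n_bracket j p u) \<bullet> (w - (1/2) *\<^sub>R n_bracket j p w)"
  unfolding left_inv_metric_def n_mult_frechet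
  by (simp add: bilinear_lneg[OF n_bracket_bilinear])

lemma left_inv_field_invariant:
  "frechet_derivative (n_mult j p) (at q) (left_inv_field j X q) = left_inv_field j X (n_mult j p q)"
  unfolding n_mult_frechet left_inv_field_eq
  by (simp add: n_bracket_def n_mult_def prod_eq_iff vb_simps scaleR_add_right)

lemma left_inv_metric_left_inv_field:
  "left_inv_metric j p (left_inv_field j X p) (left_inv_field j Y p) = X \<bullet> Y"
  by (simp add: left_inv_metric_eq left_inv_field_eq n_bracket_def vb_simps)

lemma left_inv_field_has_derivative:
  "(left_inv_field j X has_derivative (\<lambda>h. (1/2) *\<^sub>R n_bracket j h X)) (at p)"
proof -
  have "bounded_linear (\<lambda>h. n_bracket j h X)"
    using n_bracket_bilinear unfolding bilinear_def linear_conv_bounded_linear by blast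
  then have *: "((\<lambda>h. n_bracket j h X) has_derivative (\<lambda>h. n_bracket j h X)) (at p)"
    by (rule bounded_linear_imp_has_derivative)
  have "((\<lambda>p. X + (1/2) *\<^sub>R n_bracket j p X) has_derivative
      (\<lambda>h. 0 + (1/2) *\<^sub>R n_bracket j h X)) (at p)"
    by (intro has_derivative_add has_derivative_const has_derivative_scaleR_right *)
  then show ?thesis unfolding left_inv_field_eq[abs_def] by (simp only: add_0)
qed

lemma left_inv_field_frechet:
  "frechet_derivative (left_inv_field j X) (at p) = (\<lambda>h. (1/2) *\<^sub>R n_bracket j h X)"
  by (rule frechet_derivative_at[OF left_inv_field_has_derivative, symmetric])

lemma vf_bracket_left_inv_field:
  "vf_bracket (left_inv_field j X) (left_inv_field j Y) = left_inv_field j (n_bracket j X Y)"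
proof
  fix p
  have "(1/2) *\<^sub>R a + (1/2) *\<^sub>R a = a" for a :: 'z
    by (simp flip: scaleR_left_distrib)
  then have "(1/2) *\<^sub>R v_bracket j (fst X) (fst Y) - (1/2) *\<^sub>R v_bracket j (fst Y) (fst X)
      = v_bracket j (fst X) (fst Y)"
    unfolding v_bracket_antisym[of "fst Y" "fst X"] by simp
  then show "vf_bracket (left_inv_field j X) (left_inv_field j Y) p =
      left_inv_field j (n_bracket j X Y) p"
    by (simp add: vf_bracket_def dir_deriv_def left_inv_field_frechet left_inv_field_eq
        n_bracket_def vb_simps)
qed

end

section \<open>Existence of the Levi-Civita connection of \<open>N(j)\<close>\<close>

lemma Ck_Suc_imp: "Ck (Suc k) f \<Longrightarrow> Ck k f"
proof (induction k arbitrary: f)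
  case 0
  then show ?case
    by (auto simp: continuous_on_eq_continuous_at differentiable_imp_continuous_within)
next
  case (Suc k)
  then show ?case by (metis Ck.simps(2))
qed

lemma Ck_const: "Ck k (\<lambda>x. c)"
  by (induction k arbitrary: c) (auto simp: frechet_derivative_const)

lemma differentiable_has_frechet: "f differentiable (at x) \<Longrightarrow> (f has_derivative frechet_derivative f (at x)) (at x)"
  by (simp add: frechet_derivative_works)

lemma Ck_add: "Ck k f \<Longrightarrow> Ck k g \<Longrightarrow> Ck k (\<lambda>x. f x + g x)"
proof (induction k arbitrary: f g)
  case 0
  then show ?case by (auto intro: continuous_on_add)
next
  case (Suc k)
  then have d: "\<And>x. f differentiable (at x)" "\<And>x. g differentiable (at x)" by auto
  have "frechet_derivative (\<lambda>x. f x + g x) (at x) =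
      (\<lambda>h. frechet_derivative f (at x) h + frechet_derivative g (at x) h)" for x
    by (rule frechet_derivative_at[symmetric], rule has_derivative_add; rule differentiable_has_frechet; rule d)
  with Suc d show ?case by (auto intro: differentiable_add)
qed

lemma Ck_bilin:
  assumes "bounded_bilinear b"
  shows "Ck k f \<Longrightarrow> Ck k g \<Longrightarrow> Ck k (\<lambda>x. b (f x) (g x))"
proof (induction k arbitrary: f g)
  case 0
  then show ?case using bounded_bilinear.continuous_on[OF assms] by auto
next
  case (Suc k)
  then have d: "\<And>x. f differentiable (at x)" "\<And>x. g differentiable (at x)" by auto
  have h: "((\<lambda>x. b (f x) (g x)) has_derivative
      (\<lambda>h. b (f x) (frechet_derivative g (at x) h) + b (frechet_derivative f (at x) h) (g x))) (at x)" for x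
    by (rule bounded_bilinear.FDERIV[OF assms]; rule differentiable_has_frechet; rule d)
  note h' = frechet_derivative_at[OF h, symmetric]
  have "Ck k f" "Ck k g" using Suc Ck_Suc_imp by auto
  then show ?case using Suc h
    by (auto simp: h' differentiable_def intro!: Ck_add)
qed

lemma Ck_linear:
  assumes "bounded_linear b"
  shows "Ck k b"
proof (cases k)
  case 0
  then show ?thesis using assms linear_continuous_on by auto
next
  case (Suc l)
  have h: "(b has_derivative b) (at x)" for x by (rule bounded_linear_imp_has_derivative[OF assms])
  show ?thesis using Suc h by (auto simp: frechet_derivative_at[OF h, symmetric] Ck_const differentiable_def)
qed

lemma Ck_linear_comp:
  assumes b: "bounded_linear b"
  shows "Ck k f \<Longrightarrow> Ck k (\<lambda>x. b (f x))"
proof (induction k arbitrary: f)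
  case 0
  then show ?case using bounded_linear.continuous_on[OF b] by auto
next
  case (Suc k)
  then have d: "\<And>x. f differentiable (at x)" by auto
  have h: "((\<lambda>x. b (f x)) has_derivative (\<lambda>h. b (frechet_derivative f (at x) h))) (at x)" for x
    by (rule bounded_linear.has_derivative[OF b]; rule differentiable_has_frechet; rule d)
  show ?case using Suc h by (auto simp: frechet_derivative_at[OF h, symmetric] differentiable_def)
qed

lemma smooth_const: "smooth (\<lambda>x. c)"
  and smooth_add: "smooth f \<Longrightarrow> smooth g \<Longrightarrow> smooth (\<lambda>x. f x + g x)"
  and smooth_bilin: "bounded_bilinear b \<Longrightarrow> smooth f \<Longrightarrow> smooth g' \<Longrightarrow> smooth (\<lambda>x. b (f x) (g' x))"
  and smooth_linear: "bounded_linear l \<Longrightarrow> smooth l"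
  and smooth_linear_comp: "bounded_linear l' \<Longrightarrow> smooth f \<Longrightarrow> smooth (\<lambda>x. l' (f x))"
  by (simp_all add: smooth_def Ck_const Ck_add Ck_bilin Ck_linear Ck_linear_comp)

lemma smooth_ident: "smooth (\<lambda>x. x)"
  by (rule smooth_linear[OF bounded_linear_ident])

lemma smooth_sum: "finite A \<Longrightarrow> (\<And>i. i \<in> A \<Longrightarrow> smooth (f i)) \<Longrightarrow> smooth (\<lambda>x. \<Sum>i\<in>A. f i x)"
  by (induction A rule: finite_induct) (auto intro: smooth_const smooth_add)

lemma smooth_differentiable: "smooth f \<Longrightarrow> f differentiable (at x)"
  unfolding smooth_def by (metis Ck.simps(2))

lemma smooth_has_derivative: "smooth f \<Longrightarrow> (f has_derivative frechet_derivative f (at x)) (at x)"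
  by (rule differentiable_has_frechet, rule smooth_differentiable)

lemma smooth_frechet: "smooth f \<Longrightarrow> smooth (\<lambda>x. frechet_derivative f (at x) h)"
  unfolding smooth_def by (metis Ck.simps(2))

lemma smooth_dir: assumes f: "smooth f" and X: "smooth X"
  shows "smooth (\<lambda>x. frechet_derivative f (at x) (X x))"
proof -
  have "frechet_derivative f (at x) (X x) = (\<Sum>b\<in>Basis. (X x \<bullet> b) *\<^sub>R frechet_derivative f (at x) b)" for x
  proof -
    have l: "linear (frechet_derivative f (at x))" using smooth_has_derivative[OF f] has_derivative_linear by blast
    have "frechet_derivative f (at x) (X x) = frechet_derivative f (at x) (\<Sum>b\<in>Basis. (X x \<bullet> b) *\<^sub>R b)"
      by (simp add: euclidean_representation)
    then show ?thesis by (simp add: linear_sum[OF l] linear_cmul[OF l])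
  qed
  then show ?thesis
    by (auto intro!: smooth_sum smooth_bilin[OF bounded_bilinear_scaleR] smooth_frechet f X
      smooth_bilin[OF bounded_bilinear_inner] smooth_const)
qed

context two_step
begin

text \<open>The Levi-Civita connection on left-invariant fields, from the Koszul formula.\<close>

definition nab_alg :: "'v \<times> 'z \<Rightarrow> 'v \<times> 'z \<Rightarrow> 'v \<times> 'z" where
  "nab_alg X Y = (- (1/2) *\<^sub>R (j (snd Y) (fst X) + j (snd X) (fst Y)), (1/2) *\<^sub>R v_bracket j (fst X) (fst Y))"

text \<open>The components of a vector field in the left-invariant frame.\<close>

definition frame_coord :: "('v \<times> 'z) vfield \<Rightarrow> ('v \<times> 'z) vfield" where
  "frame_coord Y p = Y p - (1/2) *\<^sub>R n_bracket j p (Y p)"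

definition nab0 ::
  "('v \<times> 'z) vfield \<Rightarrow> ('v \<times> 'z) vfield \<Rightarrow> ('v \<times> 'z) vfield" where
  "nab0 X Y p = left_inv_field j (frechet_derivative (frame_coord Y) (at p) (X p) + nab_alg (frame_coord X p) (frame_coord Y p)) p"

lemmas j_simps = bilinear_ladd[OF bil] bilinear_radd[OF bil] bilinear_lmul[OF bil] bilinear_rmul[OF bil]
lemmas n_simps = bilinear_ladd[OF n_bracket_bilinear] bilinear_radd[OF n_bracket_bilinear]
 bilinear_lmul[OF n_bracket_bilinear] bilinear_rmul[OF n_bracket_bilinear]
 bilinear_rsub[OF n_bracket_bilinear]
lemma bounded_bilinear_n_bracket: "bounded_bilinear (n_bracket j)"
  using n_bracket_bilinear bilinear_conv_bounded_bilinear by blast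

lemma nab_alg_bilinear: "bilinear nab_alg"
  unfolding bilinear_def
  by (intro conjI allI linearI) (auto simp: nab_alg_def j_simps vb_simps prod_eq_iff scaleR_add_right scaleR_diff_right)

lemma bounded_bilinear_nab_alg: "bounded_bilinear nab_alg"
  using nab_alg_bilinear bilinear_conv_bounded_bilinear by blast

lemma smooth_frame: assumes "smooth Y" shows "smooth (frame_coord Y)"
proof -
  have "smooth (\<lambda>p. Y p + (-(1/2)) *\<^sub>R n_bracket j p (Y p))"
    by (rule smooth_add[OF assms smooth_bilin[OF bounded_bilinear_scaleR smooth_const smooth_bilin[OF bounded_bilinear_n_bracket smooth_ident assms]]])
  then show ?thesis unfolding frame_coord_def[abs_def] by simp
qed

lemma smooth_nab0: assumes X: "smooth X" and Y: "smooth Y" shows "smooth (nab0 X Y)"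
proof -
  have "smooth (\<lambda>p. frechet_derivative (frame_coord Y) (at p) (X p) + nab_alg (frame_coord X p) (frame_coord Y p))" (is "smooth ?F")
    by (rule smooth_add[OF smooth_dir[OF smooth_frame[OF Y] X] smooth_bilin[OF bounded_bilinear_nab_alg smooth_frame[OF X] smooth_frame[OF Y]]])
  then have "smooth (\<lambda>p. ?F p + (1/2) *\<^sub>R n_bracket j p (?F p))"
    by (intro smooth_add[OF _ smooth_bilin[OF bounded_bilinear_scaleR smooth_const smooth_bilin[OF bounded_bilinear_n_bracket smooth_ident]]])
  then show ?thesis unfolding nab0_def[abs_def] left_inv_field_eq .
qed

lemma n_bracket_two_step: "n_bracket j p (n_bracket j q r) = 0"
  by (simp add: n_bracket_def vb_simps zero_prod_def)

lemma left_inv_field_linear: "linear (\<lambda>X. left_inv_field j X p)"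
  by (intro linearI) (auto simp: left_inv_field_eq n_simps scaleR_add_right)

lemma left_inv_field_frame: "left_inv_field j (frame_coord Y p) p = Y p"
  by (simp add: left_inv_field_eq frame_coord_def n_simps n_bracket_two_step)

lemma frame_left_inv_field: "frame_coord (\<lambda>p. left_inv_field j (Y p) p) p = Y p"
  by (simp add: left_inv_field_eq frame_coord_def n_simps n_bracket_two_step)

lemma frame_nab0: "frame_coord (nab0 X Y) p = frechet_derivative (frame_coord Y) (at p) (X p) + nab_alg (frame_coord X p) (frame_coord Y p)"
  unfolding nab0_def[abs_def] by (rule frame_left_inv_field)

lemma left_inv_metric_frame: "left_inv_metric j p (Y p) (Z p) = frame_coord Y p \<bullet> frame_coord Z p"
  by (simp add: left_inv_metric_eq frame_coord_def)

lemma frame_add: "frame_coord (\<lambda>q. X q + Y q) p = frame_coord X p + frame_coord Y p"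
  by (simp add: frame_coord_def n_simps scaleR_add_right)

lemma frame_scale: "frame_coord (\<lambda>q. f q *\<^sub>R Y q) p = f p *\<^sub>R frame_coord Y p"
  by (simp add: frame_coord_def n_simps scaleR_diff_right)

lemma frechet_linear: "smooth f \<Longrightarrow> linear (frechet_derivative f (at x))"
  using smooth_has_derivative has_derivative_linear by blast

lemma frechet_add: assumes "smooth f" "smooth g"
  shows "frechet_derivative (\<lambda>q. f q + g q) (at p) h = frechet_derivative f (at p) h + frechet_derivative g (at p) h"
  using frechet_derivative_at[OF has_derivative_add[OF smooth_has_derivative[OF assms(1)] smooth_has_derivative[OF assms(2)]], symmetric]
  by simp

lemma frechet_scaleR: assumes "smooth f" "smooth g"
  shows "frechet_derivative (\<lambda>q. f q *\<^sub>R g q) (at p) h = f p *\<^sub>R frechet_derivative g (at p) h + frechet_derivative f (at p) h *\<^sub>R g p"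
  using frechet_derivative_at[OF has_derivative_scaleR[OF smooth_has_derivative[OF assms(1)] smooth_has_derivative[OF assms(2)]], symmetric]
  by simp

lemma frechet_inner: assumes "smooth f" "smooth g"
  shows "frechet_derivative (\<lambda>q. f q \<bullet> g q) (at p) h = f p \<bullet> frechet_derivative g (at p) h + frechet_derivative f (at p) h \<bullet> g p"
  using frechet_derivative_at[OF has_derivative_inner[OF smooth_has_derivative[OF assms(1)] smooth_has_derivative[OF assms(2)]], symmetric]
  by simp

lemma affine_connection_nab0: "affine_connection nab0"
  unfolding affine_connection_def
proof (intro conjI allI impI)
  fix X Y :: "'v \<times> 'z \<Rightarrow> 'v \<times> 'z" assume "smooth X" "smooth Y" then show "smooth (nab0 X Y)" by (rule smooth_nab0)
next
  fix X X' Y :: "'v \<times> 'z \<Rightarrow> 'v \<times> 'z" and p assume "smooth X" "smooth X'" "smooth Y"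
  then show "nab0 (\<lambda>q. X q + X' q) Y p = nab0 X Y p + nab0 X' Y p"
    unfolding nab0_def linear_add[OF left_inv_field_linear, symmetric]
    by (simp add: frame_add linear_add[OF frechet_linear] smooth_frame bilinear_ladd[OF nab_alg_bilinear] algebra_simps)
next
  fix X Y :: "'v \<times> 'z \<Rightarrow> 'v \<times> 'z" and f :: "'v \<times> 'z \<Rightarrow> real" and p assume "smooth f" "smooth X" "smooth Y"
  then show "nab0 (\<lambda>q. f q *\<^sub>R X q) Y p = f p *\<^sub>R nab0 X Y p"
    unfolding nab0_def linear_cmul[OF left_inv_field_linear, symmetric]
    by (simp add: frame_scale linear_cmul[OF frechet_linear] smooth_frame bilinear_lmul[OF nab_alg_bilinear] algebra_simps)
next
  fix X Y Y' :: "'v \<times> 'z \<Rightarrow> 'v \<times> 'z" and p assume "smooth X" "smooth Y" "smooth Y'"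
  then show "nab0 X (\<lambda>q. Y q + Y' q) p = nab0 X Y p + nab0 X Y' p"
    unfolding nab0_def linear_add[OF left_inv_field_linear, symmetric] frame_add[abs_def]
    by (simp add: frechet_add smooth_frame bilinear_radd[OF nab_alg_bilinear] algebra_simps)
next
  fix X Y :: "'v \<times> 'z \<Rightarrow> 'v \<times> 'z" and f :: "'v \<times> 'z \<Rightarrow> real" and p
  assume a: "smooth f" "smooth X" "smooth Y"
  have "nab0 X (\<lambda>q. f q *\<^sub>R Y q) p =
    left_inv_field j (f p *\<^sub>R (frechet_derivative (frame_coord Y) (at p) (X p) + nab_alg (frame_coord X p) (frame_coord Y p)) + dir_deriv X f p *\<^sub>R frame_coord Y p) p"
    unfolding nab0_def frame_scale[abs_def] dir_deriv_def
    using a by (simp add: frechet_scaleR smooth_frame bilinear_rmul[OF nab_alg_bilinear] algebra_simps)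
  then show "nab0 X (\<lambda>q. f q *\<^sub>R Y q) p = dir_deriv X f p *\<^sub>R Y p + f p *\<^sub>R nab0 X Y p"
    unfolding linear_add[OF left_inv_field_linear] linear_cmul[OF left_inv_field_linear] left_inv_field_frame nab0_def by simp
qed

lemma nab_alg_skew: "nab_alg x y \<bullet> z + y \<bullet> nab_alg x z = 0"
proof -
  have a: "j (snd y) (fst x) \<bullet> fst z = v_bracket j (fst x) (fst z) \<bullet> snd y"
    "j (snd z) (fst x) \<bullet> fst y = v_bracket j (fst x) (fst y) \<bullet> snd z"
    by (simp_all add: v_bracket_inner[OF bil])
  have "j (snd x) (fst y) \<bullet> fst z = - (j (snd x) (fst z) \<bullet> fst y)"
    using j_skew[of "snd x" "fst y" "fst z"] by (simp add: inner_commute)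
  then show ?thesis using a
    by (simp add: nab_alg_def inner_prod_def inner_add_left inner_add_right
        inner_diff_left inner_diff_right inner_commute field_simps)
qed

lemma levi_civita_nab0: "levi_civita (left_inv_metric j) nab0"
  unfolding levi_civita_def
proof (intro conjI allI impI affine_connection_nab0)
  fix X Y Z :: "'v \<times> 'z \<Rightarrow> 'v \<times> 'z" and p assume a: "smooth X" "smooth Y" "smooth Z"
  have s: "nab_alg (frame_coord X p) (frame_coord Y p) \<bullet> frame_coord Z p + frame_coord Y p \<bullet> nab_alg (frame_coord X p) (frame_coord Z p) = 0" by (rule nab_alg_skew)
  show "dir_deriv X (\<lambda>q. left_inv_metric j q (Y q) (Z q)) p = left_inv_metric j p (nab0 X Y p) (Z p) + left_inv_metric j p (Y p) (nab0 X Z p)"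
    unfolding left_inv_metric_frame dir_deriv_def frame_nab0
    using a s by (simp add: frechet_inner smooth_frame inner_add_left inner_add_right)
next
  fix X Y :: "'v \<times> 'z \<Rightarrow> 'v \<times> 'z" and p assume a: "smooth X" "smooth Y"
  have D: "frechet_derivative Y (at p) h = left_inv_field j (frechet_derivative (frame_coord Y) (at p) h) p + (1/2) *\<^sub>R n_bracket j h (Y p)"
    if "smooth Y" for Y :: "'v \<times> 'z \<Rightarrow> 'v \<times> 'z" and h
  proof -
    have e: "frechet_derivative (frame_coord Y) (at p) h = frechet_derivative Y (at p) h - (1/2) *\<^sub>R (n_bracket j p (frechet_derivative Y (at p) h) + n_bracket j h (Y p))"
    proof -
      have "((\<lambda>p. Y p - (1/2) *\<^sub>R n_bracket j p (Y p)) has_derivative (\<lambda>h. frechet_derivative Y (at p) h - (1/2) *\<^sub>R (n_bracket j p (frechet_derivative Y (at p) h) + n_bracket j h (Y p)))) (at p)"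
        by (intro has_derivative_diff has_derivative_scaleR_right bounded_bilinear.FDERIV[OF bounded_bilinear_n_bracket] has_derivative_ident smooth_has_derivative that)
      from frechet_derivative_at[OF this, symmetric] show ?thesis unfolding frame_coord_def[abs_def] by simp
    qed
    show ?thesis unfolding e left_inv_field_eq by (simp add: n_simps n_bracket_two_step scaleR_add_right)
  qed
  have x: "fst (frame_coord Z p) = fst (Z p)" for Z by (simp add: frame_coord_def n_bracket_def)
  have half: "(1/2) *\<^sub>R a + (1/2) *\<^sub>R a = a" for a :: 'z
    by (simp flip: scaleR_left_distrib)
  have t: "nab_alg (frame_coord X p) (frame_coord Y p) - nab_alg (frame_coord Y p) (frame_coord X p) = n_bracket j (X p) (Y p)"
    using half[of "v_bracket j (fst (X p)) (fst (Y p))"] v_bracket_antisym[of "fst (Y p)" "fst (X p)"]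
    by (simp add: nab_alg_def x n_bracket_def algebra_simps)
  have l: "left_inv_field j (n_bracket j (X p) (Y p)) p = n_bracket j (X p) (Y p)"
    by (simp add: left_inv_field_eq n_bracket_two_step)
  have h2: "(1/2) *\<^sub>R n_bracket j (X p) (Y p) - (1/2) *\<^sub>R n_bracket j (Y p) (X p) = n_bracket j (X p) (Y p)"
    using half[of "v_bracket j (fst (X p)) (fst (Y p))"] v_bracket_antisym[of "fst (Y p)" "fst (X p)"]
    by (simp add: n_bracket_def)
  have "nab0 X Y p - nab0 Y X p = left_inv_field j (frechet_derivative (frame_coord Y) (at p) (X p)) p - left_inv_field j (frechet_derivative (frame_coord X) (at p) (Y p)) p
     + left_inv_field j (nab_alg (frame_coord X p) (frame_coord Y p) - nab_alg (frame_coord Y p) (frame_coord X p)) p"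
    unfolding nab0_def linear_add[OF left_inv_field_linear] linear_diff[OF left_inv_field_linear] by simp
  also have "\<dots> = left_inv_field j (frechet_derivative (frame_coord Y) (at p) (X p)) p - left_inv_field j (frechet_derivative (frame_coord X) (at p) (Y p)) p + n_bracket j (X p) (Y p)"
    unfolding t l ..
  also have "\<dots> = vf_bracket X Y p"
    unfolding vf_bracket_def dir_deriv_def D[OF a(1)] D[OF a(2)] using h2 by (simp add: algebra_simps)
  finally show "nab0 X Y p - nab0 Y X p = vf_bracket X Y p" .
qed

theorem ex_levi_civita: "\<exists>nab. levi_civita (left_inv_metric j) nab"
  using levi_civita_nab0 by blast

end

end

theory Submission
  imports Defs
begin

text \<open>
  Write \<open>A\<^sub>X = T\<^sub>X - \<nabla>\<^sub>X\<close> in the left-invariant frame. Condition (1) makes \<open>A\<^sub>X\<close> a skew derivation of the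
  curvature, hence of the Ricci form, which is \<open>C/2\<close> on \<open>\<vv>\<close> and \<open>D/4\<close> on \<open>\<zz>\<close>. As \<open>D \<noteq> 2C\<close>, \<open>A\<^sub>X\<close>
  preserves \<open>\<vv>\<close> and \<open>\<zz>\<close>; together with the total skewness of \<open>T\<close> this determines \<open>T\<close> up to a
  3-form \<open>\<tau>\<close> on \<open>\<vv>\<close> and one on \<open>\<zz>\<close>. The \<open>\<zz>\<close>-part of \<open>T\<close> on \<open>\<vv> \<times> \<vv>\<close> is half the Lie bracket, so
  constant, and condition (2) says that \<open>A\<^sub>X\<close> is a derivation of this bracket. For \<open>X \<in> \<zz>\<close> this is
  the commutator relation between \<open>j\<close> and the 3-form on \<open>\<zz>\<close>, which determines the latter because
  \<open>j\<close> is injective; for \<open>X \<in> \<vv>\<close> it says that \<open>\<tau>\<^sub>X\<close> commutes with every \<open>j\<^sub>Z\<close>, which forces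
  \<open>\<tau> = 0\<close>.
\<close>

section \<open>Symmetry of second derivatives\<close>

text \<open>The mean value theorem, applied along \<open>u\<close> and then along \<open>w\<close>,
  turns the second difference into \<open>t\<^sup>2\<close> times the mixed derivative at a nearby
  point. The quotient is symmetric in \<open>u\<close> and \<open>w\<close>, so uniqueness of limits
  gives the symmetry of second derivatives.\<close>

lemma second_difference_tendsto:
  fixes f :: "'a::euclidean_space \<Rightarrow> real"
  assumes f: "smooth f"
  shows "((\<lambda>t. (f (p + t *\<^sub>R u + t *\<^sub>R w) - f (p + t *\<^sub>R u) - f (p + t *\<^sub>R w) + f p) / t\<^sup>2)
    \<longlongrightarrow> frechet_derivative (\<lambda>q. frechet_derivative f (at q) u) (at p) w) (at_right 0)"
proof -
  define g where "g q = frechet_derivative f (at q) u" for q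
  define G where "G q = frechet_derivative g (at q) w" for q
  have sg: "smooth g" unfolding g_def by (rule smooth_frechet[OF f])
  have sG: "smooth G" unfolding G_def by (rule smooth_frechet[OF sg])
  have contG: "isCont G p"
    using smooth_has_derivative[OF sG] has_derivative_continuous by blast
  have line: "((\<lambda>s. h (a + s *\<^sub>R v)) has_real_derivative frechet_derivative h (at (a + s *\<^sub>R v)) v) (at s)"
    if "smooth h" for h :: "'a \<Rightarrow> real" and a v s
  proof -
    have "((\<lambda>s. a + s *\<^sub>R v) has_derivative (\<lambda>k. 0 + k *\<^sub>R v)) (at s)"
      by (intro has_derivative_add has_derivative_const has_derivative_scaleR_left has_derivative_ident)
    from has_derivative_compose[OF this smooth_has_derivative[OF that]]
    show ?thesis
      by (rule has_derivative_imp_has_field_derivative)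
        (simp add: linear_cmul[OF has_derivative_linear[OF smooth_has_derivative[OF that]]])
  qed
  define X where "X t = (f (p + t *\<^sub>R u + t *\<^sub>R w) - f (p + t *\<^sub>R u) - f (p + t *\<^sub>R w) + f p) / t\<^sup>2" for t :: real
  have mv: "\<exists>a b. 0 \<le> a \<and> a \<le> t \<and> 0 \<le> b \<and> b \<le> t \<and> X t = G (p + a *\<^sub>R u + b *\<^sub>R w)"
    if t: "t > 0" for t
  proof -
    let ?h = "\<lambda>s. f ((p + t *\<^sub>R w) + s *\<^sub>R u) - f (p + s *\<^sub>R u)"
    have "\<exists>a. 0 < a \<and> a < t \<and> ?h t - ?h 0 = (t - 0) * (g ((p + t *\<^sub>R w) + a *\<^sub>R u) - g (p + a *\<^sub>R u))"
      unfolding g_def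
      by (rule MVT2[OF t]) (intro DERIV_diff line f)
    then obtain a where a: "0 < a" "a < t"
      and ea: "?h t - ?h 0 = t * (g ((p + t *\<^sub>R w) + a *\<^sub>R u) - g (p + a *\<^sub>R u))" by auto
    let ?k = "\<lambda>r. g ((p + a *\<^sub>R u) + r *\<^sub>R w)"
    have "\<exists>b. 0 < b \<and> b < t \<and> ?k t - ?k 0 = (t - 0) * G ((p + a *\<^sub>R u) + b *\<^sub>R w)"
      unfolding G_def by (rule MVT2[OF t]) (intro line sg)
    then obtain b where b: "0 < b" "b < t" and eb: "?k t - ?k 0 = t * G ((p + a *\<^sub>R u) + b *\<^sub>R w)" by auto
    have "X t = G (p + a *\<^sub>R u + b *\<^sub>R w)"
      using ea eb t by (simp add: X_def power2_eq_square field_simps)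
    with a b show ?thesis by (meson less_imp_le)
  qed
  have "(X \<longlongrightarrow> G p) (at_right 0)"
    unfolding tendsto_iff
  proof (intro allI impI)
    fix e :: real assume "e > 0"
    then obtain d where d: "d > 0" "\<And>q. dist q p < d \<Longrightarrow> dist (G q) (G p) < e"
      using contG unfolding continuous_at_eps_delta by blast
    \<comment> \<open>The displacement has norm at most \<open>t * (norm u + norm w)\<close>; the
      summand 1 keeps the denominator positive when \<open>u\<close> and \<open>w\<close>
      vanish.\<close>
    define c where "c = d / (norm u + norm w + 1)"
    have n: "norm u + norm w + 1 > 0" by (smt (verit) norm_ge_zero)
    have c: "c > 0" using d n by (simp add: c_def)
    have "dist (X t) (G p) < e" if t: "0 < t" "t < c" for t
    proof -
      obtain a b where ab: "0 \<le> a" "a \<le> t" "0 \<le> b" "b \<le> t" "X t = G (p + a *\<^sub>R u + b *\<^sub>R w)"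
        using mv t by blast
      have "norm (a *\<^sub>R u + b *\<^sub>R w) \<le> a * norm u + b * norm w"
        using ab by (intro order_trans[OF norm_triangle_ineq]) simp
      also have "\<dots> \<le> t * norm u + t * norm w"
        using ab by (intro add_mono mult_right_mono) auto
      also have "\<dots> < t * (norm u + norm w + 1)" using t by (simp add: algebra_simps)
      also have "\<dots> < d" using t n by (simp add: c_def field_simps)
      finally show ?thesis using d(2)[of "p + a *\<^sub>R u + b *\<^sub>R w"] ab(5)
        by (simp add: dist_norm add.assoc)
    qed
    then show "eventually (\<lambda>t. dist (X t) (G p) < e) (at_right 0)"
      unfolding eventually_at_right_field using c by blast
  qed
  then show ?thesis unfolding X_def G_def g_def .
qed

lemma frechet_derivative_commute_real:
  fixes f :: "'a::euclidean_space \<Rightarrow> real"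
  assumes "smooth f"
  shows "frechet_derivative (\<lambda>q. frechet_derivative f (at q) u) (at p) w =
    frechet_derivative (\<lambda>q. frechet_derivative f (at q) w) (at p) u"
proof (rule tendsto_unique[OF _ second_difference_tendsto[OF assms]])
  have e: "f (p + t *\<^sub>R w + t *\<^sub>R u) - f (p + t *\<^sub>R w) - f (p + t *\<^sub>R u) + f p =
      f (p + t *\<^sub>R u + t *\<^sub>R w) - f (p + t *\<^sub>R u) - f (p + t *\<^sub>R w) + f p" for t
    by (simp add: add_ac)
  show "((\<lambda>t. (f (p + t *\<^sub>R u + t *\<^sub>R w) - f (p + t *\<^sub>R u) - f (p + t *\<^sub>R w) + f p) / t\<^sup>2)
    \<longlongrightarrow> frechet_derivative (\<lambda>q. frechet_derivative f (at q) w) (at p) u) (at_right 0)"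
    using second_difference_tendsto[OF assms, of p w u] unfolding e .
qed simp

section \<open>Derivative rules for vector-valued smooth maps\<close>

lemma frechet_derivative_linear_comp:
  assumes "bounded_linear l" "smooth f"
  shows "frechet_derivative (\<lambda>q. l (f q)) (at p) h = l (frechet_derivative f (at p) h)"
  using frechet_derivative_at[OF bounded_linear.has_derivative[OF assms(1) smooth_has_derivative[OF assms(2)]], symmetric]
  by simp

lemma frechet_derivative_commute:
  fixes f :: "'a::euclidean_space \<Rightarrow> 'b::euclidean_space"
  assumes f: "smooth f"
  shows "frechet_derivative (\<lambda>q. frechet_derivative f (at q) u) (at p) w =
    frechet_derivative (\<lambda>q. frechet_derivative f (at q) w) (at p) u"
proof (rule euclidean_eqI)
  fix b :: 'b
  have l: "bounded_linear (\<lambda>y. y \<bullet> b)" by (rule bounded_linear_inner_left)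
  have e: "frechet_derivative (\<lambda>q. frechet_derivative f (at q) u) (at p) w \<bullet> b =
      frechet_derivative (\<lambda>q. frechet_derivative (\<lambda>q. f q \<bullet> b) (at q) u) (at p) w" for u w
    using frechet_derivative_linear_comp[OF l f]
      frechet_derivative_linear_comp[OF l smooth_frechet[OF f]] by simp
  show "frechet_derivative (\<lambda>q. frechet_derivative f (at q) u) (at p) w \<bullet> b =
      frechet_derivative (\<lambda>q. frechet_derivative f (at q) w) (at p) u \<bullet> b"
    unfolding e by (rule frechet_derivative_commute_real[OF smooth_linear_comp[OF l f]])
qed

text \<open>Product rule for the derivative of \<open>f\<close> paired with a varying direction. The
  first term freezes the direction at \<open>p\<close>, which leaves a genuine second derivative to
  which symmetry applies.\<close>

lemma frechet_derivative_dir: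
  fixes f :: "'a::euclidean_space \<Rightarrow> 'b::euclidean_space"
  assumes f: "smooth f" and Y: "smooth Y"
  shows "frechet_derivative (\<lambda>q. frechet_derivative f (at q) (Y q)) (at p) h =
    frechet_derivative (\<lambda>q. frechet_derivative f (at q) (Y p)) (at p) h +
    frechet_derivative f (at p) (frechet_derivative Y (at p) h)"
proof -
  have lin: "linear (frechet_derivative f (at q))" for q
    using smooth_has_derivative[OF f] has_derivative_linear by blast
  have ex: "frechet_derivative f (at q) y = (\<Sum>b\<in>Basis. (y \<bullet> b) *\<^sub>R frechet_derivative f (at q) b)" for q y
    by (subst euclidean_representation[of y, symmetric])
      (simp add: linear_sum[OF lin] linear_cmul[OF lin])
  have D: "((\<lambda>q. \<Sum>b\<in>Basis. (Z q \<bullet> b) *\<^sub>R frechet_derivative f (at q) b) has_derivative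
     (\<lambda>h. \<Sum>b\<in>Basis. (Z p \<bullet> b) *\<^sub>R frechet_derivative (\<lambda>q. frechet_derivative f (at q) b) (at p) h
        + (frechet_derivative Z (at p) h \<bullet> b) *\<^sub>R frechet_derivative f (at p) b)) (at p)"
    if "smooth Z" for Z :: "'a \<Rightarrow> 'a"
    by (intro has_derivative_sum has_derivative_scaleR has_derivative_inner_left
        smooth_has_derivative that smooth_frechet f)
  have D': "frechet_derivative (\<lambda>q. frechet_derivative f (at q) (Z q)) (at p) h =
      (\<Sum>b\<in>Basis. (Z p \<bullet> b) *\<^sub>R frechet_derivative (\<lambda>q. frechet_derivative f (at q) b) (at p) h)
      + frechet_derivative f (at p) (frechet_derivative Z (at p) h)" if "smooth Z" for Z :: "'a \<Rightarrow> 'a"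
    using frechet_derivative_at[OF D[OF that], symmetric]
    by (simp add: sum.distrib flip: ex)
  show ?thesis
    using D'[OF Y] D'[OF smooth_const[of "Y p"]]
    by (simp add: linear_0[OF lin] frechet_derivative_const)
qed

lemma smooth_minus: "smooth f \<Longrightarrow> smooth g \<Longrightarrow> smooth (\<lambda>q. f q - g q)"
  using smooth_add[OF _ smooth_linear_comp[OF bounded_linear_minus[OF bounded_linear_ident]]] by fastforce

lemma frechet_derivative_bilinear:
  assumes "bounded_bilinear b" "smooth f" "smooth g"
  shows "frechet_derivative (\<lambda>q. b (f q) (g q)) (at p) h =
    b (f p) (frechet_derivative g (at p) h) + b (frechet_derivative f (at p) h) (g p)"
  using frechet_derivative_at[OF bounded_bilinear.FDERIV[OF assms(1) smooth_has_derivative[OF assms(2)]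
        smooth_has_derivative[OF assms(3)]], symmetric] by simp

section \<open>The Ricci form in the left-invariant frame\<close>

lemma sum_Basis_prod:
  fixes f :: "'a::euclidean_space \<times> 'b::euclidean_space \<Rightarrow> 'c::comm_monoid_add"
  shows "sum f Basis = (\<Sum>b\<in>Basis. f (b, 0)) + (\<Sum>b\<in>Basis. f (0, b))"
  unfolding Basis_prod_def
  by (subst sum.union_disjoint) (auto simp: sum.reindex inj_on_def)

text \<open>Both sides are traces: tr(FA) = tr(AF), and skewness of \<open>A\<close> moves it to the
  other argument of the inner product.\<close>

lemma sum_Basis_skew:
  fixes F A :: "'a::euclidean_space \<Rightarrow> 'a"
  assumes F: "linear F" and A: "\<And>x y. A x \<bullet> y + x \<bullet> A y = 0"
  shows "(\<Sum>b\<in>Basis. F (A b) \<bullet> b) = - (\<Sum>b\<in>Basis. F b \<bullet> A b)"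
proof -
  have "F (A b) \<bullet> b = (\<Sum>c\<in>Basis. (A b \<bullet> c) * (F c \<bullet> b))" for b
    by (subst euclidean_representation[of "A b", symmetric])
      (simp add: linear_sum[OF F] linear_cmul[OF F] inner_sum_left)
  also have "(\<Sum>c\<in>Basis. (A b \<bullet> c) * (F c \<bullet> b)) = - (\<Sum>c\<in>Basis. (F c \<bullet> b) * (A c \<bullet> b))" for b
  proof -
    have "A b \<bullet> c = - (A c \<bullet> b)" for c using A[of b c] by (simp add: inner_commute)
    then show ?thesis by (simp add: sum_negf mult.commute)
  qed
  finally have "(\<Sum>b\<in>Basis. F (A b) \<bullet> b) = - (\<Sum>b\<in>Basis. \<Sum>c\<in>Basis. (F c \<bullet> b) * (A c \<bullet> b))"
    by (simp add: sum_negf)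
  also have "\<dots> = - (\<Sum>c\<in>Basis. \<Sum>b\<in>Basis. (F c \<bullet> b) * (A c \<bullet> b))"
    by (subst sum.swap) (rule refl)
  finally show ?thesis by (simp flip: euclidean_inner)
qed

section \<open>Curvature and Ricci form on left-invariant fields\<close>

context two_step
begin

lemma nab_alg_torsion: "nab_alg x y - nab_alg y x = n_bracket j x y"
proof -
  have half: "(1/2) *\<^sub>R a + (1/2) *\<^sub>R a = a" for a :: 'z
    by (simp flip: scaleR_left_distrib)
  show ?thesis
    using half[of "v_bracket j (fst x) (fst y)"]
    by (simp add: nab_alg_def n_bracket_def v_bracket_antisym[of "fst y" "fst x"] algebra_simps)
qed

definition curv_alg :: "'v \<times> 'z \<Rightarrow> 'v \<times> 'z \<Rightarrow> 'v \<times> 'z \<Rightarrow> 'v \<times> 'z" where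
  "curv_alg x y z = nab_alg x (nab_alg y z) - nab_alg y (nab_alg x z) - nab_alg (n_bracket j x y) z"

text \<open>With this sign of the curvature, tracing the first slot gives the usual Ricci form:
  nonpositive on v, nonnegative on z.\<close>

definition ricci_alg :: "'v \<times> 'z \<Rightarrow> 'v \<times> 'z \<Rightarrow> real" where
  "ricci_alg y z = (\<Sum>b\<in>Basis. curv_alg b y z \<bullet> b)"

lemmas nab_alg_simps =
  bilinear_ladd[OF nab_alg_bilinear] bilinear_radd[OF nab_alg_bilinear]
  bilinear_lmul[OF nab_alg_bilinear] bilinear_rmul[OF nab_alg_bilinear]

lemma curv_alg_linear:
  "linear (\<lambda>x. curv_alg x y z)" "linear (\<lambda>y. curv_alg x y z)" "linear (\<lambda>z. curv_alg x y z)"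
  by (rule linearI; simp add: curv_alg_def n_simps nab_alg_simps algebra_simps)+

text \<open>Skewness of \<open>nab_alg\<close> removes the nested applications, so the Ricci trace
  needs only single values of \<open>nab_alg\<close>.\<close>

lemma curv_alg_inner:
  "curv_alg x y z \<bullet> w =
    nab_alg x z \<bullet> nab_alg y w - nab_alg y z \<bullet> nab_alg x w - nab_alg (n_bracket j x y) z \<bullet> w"
  using nab_alg_skew[of x "nab_alg y z" w] nab_alg_skew[of y "nab_alg x z" w]
  by (simp add: curv_alg_def inner_diff_left)

lemma J_op_inner: "J_op j x \<bullet> y = - (\<Sum>z\<in>Basis. j z x \<bullet> j z y)"
  by (simp add: J_op_def inner_sum_left j_skew[of _ "j _ x"] sum_negf)

lemma B_op_inner: "B_op j z \<bullet> w = (\<Sum>v\<in>Basis. j z v \<bullet> j w v)"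
  unfolding B_op_def inner_sum_left v_bracket_inner[OF bil] by (simp add: inner_commute)

lemma sum_v_bracket_inner:
  "(\<Sum>b\<in>Basis. v_bracket j b x \<bullet> v_bracket j b y) = - (J_op j x \<bullet> y)"
proof -
  have "v_bracket j b x \<bullet> c = - (j c x \<bullet> b)" for b c x
    unfolding v_bracket_inner[OF bil] using j_skew[of c b x] by (simp add: inner_commute)
  then have "v_bracket j b x \<bullet> v_bracket j b y = (\<Sum>c\<in>Basis. (j c x \<bullet> b) * (j c y \<bullet> b))" for b
    by (subst euclidean_inner) simp
  then have "(\<Sum>b\<in>Basis. v_bracket j b x \<bullet> v_bracket j b y) =
      (\<Sum>c\<in>Basis. \<Sum>b\<in>Basis. (j c x \<bullet> b) * (j c y \<bullet> b))"
    by (simp, subst sum.swap) (rule refl)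
  then show ?thesis by (simp add: J_op_inner flip: euclidean_inner)
qed

text \<open>The directions in v contribute a quarter of \<open>B_op\<close> and three quarters of
  \<open>J_op\<close>; those in z contribute minus a quarter of \<open>J_op\<close>.\<close>

lemma ricci_alg_eq: "ricci_alg y z = (1/4) * (B_op j (snd y) \<bullet> snd z) + (1/2) * (J_op j (fst y) \<bullet> fst z)"
proof -
  have v: "curv_alg (b, 0) y z \<bullet> (b, 0) = (1/4) * (j (snd y) b \<bullet> j (snd z) b)
      - (3/4) * (v_bracket j b (fst y) \<bullet> v_bracket j b (fst z))" for b
  proof -
    have "j (v_bracket j b (fst y)) (fst z) \<bullet> b = - (v_bracket j b (fst y) \<bullet> v_bracket j b (fst z))"
      unfolding v_bracket_inner[OF bil, symmetric] v_bracket_antisym[of "fst z" b]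
      by (simp add: inner_commute)
    then show ?thesis
      unfolding curv_alg_inner
      by (simp add: nab_alg_def n_bracket_def vb_simps bilinear_lzero[OF bil]
          bilinear_rzero[OF bil] v_bracket_antisym[of "fst y" b] inner_commute)
  qed
  have z: "curv_alg (0, b) y z \<bullet> (0, b) = (1/4) * (j b (fst y) \<bullet> j b (fst z))" for b
    unfolding curv_alg_inner
    by (simp add: nab_alg_def n_bracket_def vb_simps bilinear_lzero[OF bil]
          bilinear_rzero[OF bil] inner_commute)
  show ?thesis
    unfolding ricci_alg_def sum_Basis_prod v z sum_subtractf sum_distrib_left[symmetric]
      sum_v_bracket_inner
    by (simp add: J_op_inner B_op_inner)
qed

text \<open>Tracing the derivation identity leaves two terms with \<open>A\<close> on the traced
  vector, and these cancel by \<open>sum_Basis_skew\<close>.\<close>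

lemma ricci_alg_derivation:
  assumes skew: "\<And>x y. A x \<bullet> y + x \<bullet> A y = 0"
    and der: "\<And>x y z. A (curv_alg x y z) = curv_alg (A x) y z + curv_alg x (A y) z + curv_alg x y (A z)"
  shows "ricci_alg (A y) z + ricci_alg y (A z) = 0"
proof -
  have e: "curv_alg b (A y) z \<bullet> b + curv_alg b y (A z) \<bullet> b =
      - (curv_alg b y z \<bullet> A b) - curv_alg (A b) y z \<bullet> b" for b
    using der[of b y z] skew[of "curv_alg b y z" b] by (simp add: inner_add_left)
  have "ricci_alg (A y) z + ricci_alg y (A z) =
      - (\<Sum>b\<in>Basis. curv_alg b y z \<bullet> A b) - (\<Sum>b\<in>Basis. curv_alg (A b) y z \<bullet> b)"
    unfolding ricci_alg_def sum.distrib[symmetric] e by (simp add: sum_subtractf sum_negf)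
  then show ?thesis using sum_Basis_skew[OF curv_alg_linear(1)[of y z] skew] by simp
qed

text \<open>Up to sign, the quadratic forms of \<open>J_op\<close> and \<open>B_op\<close> are sums
  of squares of the values of \<open>j\<close>. If \<open>C\<close> or \<open>D\<close> is zero then
  \<open>j\<close> vanishes, hence both constants are zero, against \<open>D \<noteq> 2 * C\<close>.
  Injectivity of \<open>j\<close> then follows from \<open>D \<noteq> 0\<close>.\<close>

lemma nondegenerate:
  assumes J: "\<And>x. J_op j x = C *\<^sub>R x" and B: "\<And>z. B_op j z = D *\<^sub>R z" and CD: "D \<noteq> 2 * C"
  shows "C \<noteq> 0" "j z = (\<lambda>x. 0) \<Longrightarrow> z = 0"
proof -
  have zero: "j z x = 0" if "C = 0 \<or> D = 0" for z x
    using that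
  proof
    assume "C = 0"
    then have "(\<Sum>c\<in>Basis. j c x \<bullet> j c x) = 0" for x using J[of x] J_op_inner[of x x] by simp
    then have b: "j c x = 0" if "c \<in> Basis" for c x using that
      by (simp add: sum_nonneg_eq_0_iff)
    have "linear (\<lambda>z. j z x)" using bil by (simp add: bilinear_def)
    from linear_eq_stdbasis[OF this linear_zero] b show ?thesis by metis
  next
    assume "D = 0"
    then have "(\<Sum>v\<in>Basis. j z v \<bullet> j z v) = 0" for z using B[of z] B_op_inner[of z z] by simp
    then have b: "j z v = 0" if "v \<in> Basis" for z v using that
      by (simp add: sum_nonneg_eq_0_iff)
    have "linear (j z)" using bil by (simp add: bilinear_def)
    from linear_eq_stdbasis[OF this linear_zero] b show ?thesis by metis
  qed
  have CD0: "C \<noteq> 0 \<and> D \<noteq> 0"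
  proof (rule ccontr)
    assume "\<not> ?thesis"
    then have z: "j z x = 0" for z x using zero by blast
    have "C *\<^sub>R x = 0" for x :: 'v using J[of x] by (simp add: J_op_def z)
    then have "C = 0"
      using nonempty_Basis by (metis ex_in_conv nonzero_Basis scaleR_eq_0_iff)
    moreover have "D *\<^sub>R x = 0" for x :: 'z using B[of x] B_op_inner[of x "D *\<^sub>R x"] by (simp add: z)
    then have "D = 0"
      using nonempty_Basis by (metis ex_in_conv nonzero_Basis scaleR_eq_0_iff)
    ultimately show False using CD by simp
  qed
  then show "C \<noteq> 0" by simp
  show "z = 0" if "j z = (\<lambda>x. 0)"
    using CD0 B[of z] B_op_inner[of z z] that by simp
qed

text \<open>A skew map that annihilates the Ricci form commutes with the Ricci operator and
  preserves its eigenspaces; these are v and z, since the eigenvalues C/2 and D/4 differ.\<close>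

lemma derivation_preserves_factors:
  assumes J: "\<And>x. J_op j x = C *\<^sub>R x" and B: "\<And>z. B_op j z = D *\<^sub>R z" and CD: "D \<noteq> 2 * C"
    and skew: "\<And>x y. A x \<bullet> y + x \<bullet> A y = 0"
    and der: "\<And>x y z. A (curv_alg x y z) = curv_alg (A x) y z + curv_alg x (A y) z + curv_alg x y (A z)"
  shows "snd (A (x, 0)) = 0" "fst (A (0, z)) = 0"
proof -
  have z: "snd (A (x, 0)) \<bullet> w = 0" for x w
  proof -
    have "(D / 4) * (snd (A (x, 0)) \<bullet> w) + (C / 2) * (x \<bullet> fst (A (0, w))) = 0"
      using ricci_alg_derivation[OF skew der, of "(x, 0)" "(0, w)"] by (simp add: ricci_alg_eq J B)
    moreover have "x \<bullet> fst (A (0, w)) = - (snd (A (x, 0)) \<bullet> w)"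
      using skew[of "(x, 0)" "(0, w)"] by (simp add: inner_prod_def)
    ultimately have "(D / 4 - C / 2) * (snd (A (x, 0)) \<bullet> w) = 0" by (simp add: algebra_simps)
    then show ?thesis using CD by auto
  qed
  then show "snd (A (x, 0)) = 0" by (metis inner_eq_zero_iff)
  have "x \<bullet> fst (A (0, z)) = 0" for x
    using skew[of "(x, 0)" "(0, z)"] z[of x z] by (simp add: inner_prod_def)
  then show "fst (A (0, z)) = 0" by (metis inner_eq_zero_iff)
qed

end

section \<open>Totally skew tensors parallel along the bracket\<close>

text \<open>Moving an operator \<open>L\<close> between two slots of the 3-form \<open>\<lambda>x y z. \<tau> x y \<bullet> z\<close> changes the
  sign; passing through all three slots returns the negative of the original.\<close>

lemma commuting_three_form_zero:
  fixes \<tau> :: "'a::real_inner \<Rightarrow> 'a \<Rightarrow> 'a"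
  assumes anti: "\<And>x y. \<tau> y x = - \<tau> x y"
    and skew: "\<And>x y z. \<tau> x y \<bullet> z = - (y \<bullet> \<tau> x z)"
    and L: "\<And>x y. L x \<bullet> y = - (x \<bullet> L y)"
    and comm: "\<And>x y. L (\<tau> x y) = \<tau> x (L y)"
  shows "L (\<tau> x y) = 0"
proof -
  have s23: "\<tau> x (L y) \<bullet> z = - (\<tau> x y \<bullet> L z)" for x y z
    using L[of "\<tau> x y" z] by (simp add: comm)
  have cyc: "\<tau> x y \<bullet> z = \<tau> y z \<bullet> x" for x y z
    using skew[of y x z] anti[of x y] by (simp add: inner_commute)
  have "\<tau> x (L y) \<bullet> z = 0" for z
    using s23[of x y z] s23[of y x z] s23[of y z x] s23[of z x y] s23[of z y x] s23[of x z y]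
      cyc[of x "L y" z] cyc[of x y "L z"] cyc[of "L x" y z]
      cyc[of "L y" z x] cyc[of y "L z" x] cyc[of y z "L x"]
      cyc[of "L z" x y] cyc[of z "L x" y] cyc[of z x "L y"]
      anti[of x "L y"] anti[of y "L x"] anti[of x "L z"] anti[of z "L x"] anti[of "L y" z] anti[of y "L z"]
    by simp
  then show ?thesis by (metis comm inner_eq_zero_iff)
qed

lemma inner_ext: "(\<And>w. x \<bullet> w = y \<bullet> w) \<Longrightarrow> x = y" for x y :: "'a::real_inner"
  using vector_eq_rdot by blast

section \<open>The algebraic form of the structure tensor at one point\<close>

context two_step
begin

text \<open>Here \<open>t\<close> stands for the components of the tensor at a fixed point.
  Hypothesis \<open>par\<close> concerns only the z-component on pairs from v, because only this
  component is known to be constant beforehand.\<close>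

lemma structure_tensor_form:
  fixes t :: "'v \<times> 'z \<Rightarrow> 'v \<times> 'z \<Rightarrow> 'v \<times> 'z"
  assumes J: "\<And>x. J_op j x = C *\<^sub>R x" and B: "\<And>z. B_op j z = D *\<^sub>R z" and CD: "D \<noteq> 2 * C"
    and t_bil: "bilinear t" and t_alt: "\<And>x. t x x = 0"
    and t_skew: "\<And>x y z. t x y \<bullet> z + y \<bullet> t x z = 0"
    and A_def: "\<And>x y. A x y = t x y - nab_alg x y"
    and der: "\<And>v x y z. A v (curv_alg x y z) =
      curv_alg (A v x) y z + curv_alg x (A v y) z + curv_alg x y (A v z)"
    and par: "\<And>x y z. snd (A x (t (y, 0) (z, 0)) - t (A x (y, 0)) (z, 0) - t (y, 0) (A x (z, 0))) = 0"
  defines "Tz \<equiv> \<lambda>x y. snd (t (0, x) (0, y))"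
  shows "lie_bracket Tz" "\<And>z. Tz z \<in> so"
    "\<And>x y v. j x (j y v) - j y (j x v) = j (Tz x y) v"
    "\<And>X Y. t X Y = (- (1/2) *\<^sub>R j (snd Y) (fst X) + (1/2) *\<^sub>R j (snd X) (fst Y),
             (1/2) *\<^sub>R v_bracket j (fst X) (fst Y) + Tz (snd X) (snd Y))"
proof -
  note t_simps = bilinear_ladd[OF t_bil] bilinear_radd[OF t_bil] bilinear_lmul[OF t_bil]
    bilinear_rmul[OF t_bil] bilinear_lzero[OF t_bil] bilinear_rzero[OF t_bil]
  note nab0_simps = nab_alg_def vb_simps bilinear_lzero[OF bil] bilinear_rzero[OF bil]
  have t_anti: "t y x = - t x y" for x y
    using t_alt[of "x + y"] t_alt[of x] t_alt[of y] by (simp add: t_simps add_eq_0_iff)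
  have A_skew: "A v x \<bullet> y + x \<bullet> A v y = 0" for v x y
    using t_skew[of v x y] nab_alg_skew[of v x y]
    by (simp add: A_def inner_diff_left inner_diff_right)
  note A_pres = derivation_preserves_factors[where A = "A _", OF J B CD A_skew der]
  define \<tau> where "\<tau> x y = fst (t (x, 0) (y, 0))" for x y
  \<comment> \<open>\<open>A (x, 0)\<close> preserves v, so the z-component is that of
    \<open>nab_alg\<close>; the v-component \<tau> is still free.\<close>
  have tvv: "t (x, 0) (y, 0) = (\<tau> x y, (1/2) *\<^sub>R v_bracket j x y)" for x y
    using A_pres(1)[of "(x, 0)" y] by (simp add: A_def \<tau>_def nab0_simps prod_eq_iff)
  \<comment> \<open>Preservation of v and of z gives one component of each mixed value; antisymmetry
    supplies the other.\<close>
  have tzv: "t (0, z) (x, 0) = ((1/2) *\<^sub>R j z x, 0)" and tvz: "t (x, 0) (0, z) = (- (1/2) *\<^sub>R j z x, 0)" for x z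
    using A_pres(1)[of "(0, z)" x] A_pres(2)[of "(x, 0)" z] t_anti[of "(x, 0)" "(0, z)"]
    by (simp_all add: A_def nab0_simps prod_eq_iff)
  have tzz: "t (0, x) (0, y) = (0, Tz x y)" for x y
    using A_pres(2)[of "(0, x)" y] by (simp add: A_def Tz_def nab0_simps prod_eq_iff)
  have half: "(1/2) *\<^sub>R a + (1/2) *\<^sub>R a = a" for a :: 'v
    by (simp flip: scaleR_left_distrib)
  \<comment> \<open>The two halves in \<open>t\<close> and \<open>nab_alg\<close> cancel in
    \<open>Avz\<close> and add up to the full \<open>j z\<close> in \<open>Azv\<close>.\<close>
  have Avv: "A (x, 0) (y, 0) = (\<tau> x y, 0)" and Avz: "A (x, 0) (0, z) = (0, 0)"
    and Azv: "A (0, z) (x, 0) = (j z x, 0)" and Azz: "A (0, w) (0, z) = (0, Tz w z)" for x y z w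
    by (simp_all add: A_def tvv tzv tvz tzz nab0_simps half zero_prod_def)
  have A_add: "A v (x + y) = A v x + A v y" for v x y
    by (simp add: A_def t_simps nab_alg_simps)
  have par': "snd (A x (t (y, 0) (z, 0))) =
      snd (t (A x (y, 0)) (z, 0)) + snd (t (y, 0) (A x (z, 0)))" for x y z
    using par[of x y z] by (simp add: tvv algebra_simps)
  have split: "p = (fst p, 0) + (0, snd p)" for p :: "'v \<times> 'z" by simp
  have A_tvv: "A v (t (y, 0) (z, 0)) = A v (\<tau> y z, 0) + A v (0, (1/2) *\<^sub>R v_bracket j y z)" for v y z
    unfolding A_add[symmetric] tvv by simp

  have Tz_bil: "bilinear Tz"
  proof -
    have "t (0, x) (0, a + b) = t (0, x) (0, a) + t (0, x) (0, b)"
      "t (0, a + b) (0, x) = t (0, a) (0, x) + t (0, b) (0, x)"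
      "t (0, x) (0, r *\<^sub>R a) = r *\<^sub>R t (0, x) (0, a)"
      "t (0, r *\<^sub>R a) (0, x) = r *\<^sub>R t (0, a) (0, x)" for a b x r
      using t_simps(1)[of "(0, a)" "(0, b)" "(0, x)"] t_simps(2)[of "(0, x)" "(0, a)" "(0, b)"]
        t_simps(3)[of r "(0, a)" "(0, x)"] t_simps(4)[of "(0, x)" r "(0, a)"] by simp_all
    then show ?thesis
      unfolding bilinear_def Tz_def by (intro conjI allI linearI) simp_all
  qed
  have Tz_skew: "Tz x y \<bullet> z = - (y \<bullet> Tz x z)" for x y z
    using t_skew[of "(0, x)" "(0, y)" "(0, z)"] by (simp add: tzz)
  then show so: "\<And>z. Tz z \<in> so"
    using Tz_bil by (auto simp: so_def bilinear_def)
  \<comment> \<open>For a first argument in z, \<open>par'\<close> says that \<open>j x\<close> on v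
    and \<open>Tz x\<close> on z form a derivation of the bracket; pairing with \<open>y\<close>
    yields the commutator.\<close>
  show hom: "j x (j y v) - j y (j x v) = j (Tz x y) v" for x y v
  proof (rule inner_ext)
    fix w
    have "Tz x (v_bracket j v w) = v_bracket j (j x v) w + v_bracket j v (j x w)"
    proof -
      have "(1/2) *\<^sub>R Tz x (v_bracket j v w) =
          (1/2) *\<^sub>R (v_bracket j (j x v) w + v_bracket j v (j x w))"
        using par'[of "(0, x)" v w] unfolding A_tvv
        by (simp add: Azv Azz tvv bilinear_rmul[OF Tz_bil] scaleR_add_right)
      then show ?thesis by simp
    qed
    then have "Tz x (v_bracket j v w) \<bullet> y = (v_bracket j (j x v) w + v_bracket j v (j x w)) \<bullet> y" by simp
    then have "- (j (Tz x y) v \<bullet> w) = j y (j x v) \<bullet> w + j y v \<bullet> j x w"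
      by (simp add: Tz_skew inner_add_left v_bracket_inner[OF bil])
    then show "(j x (j y v) - j y (j x v)) \<bullet> w = j (Tz x y) v \<bullet> w"
      using j_skew[of x "j y v" w] by (simp add: inner_diff_left)
  qed
  \<comment> \<open>For a first argument in v, \<open>A\<close> kills z, so \<open>par'\<close>
    makes \<tau> x a derivation of the bracket with zero action on its values. Pairing with
    \<open>w\<close> and skewness of \<tau> x give commutation with \<open>j w\<close>.\<close>
  have \<tau>_comm: "j w (\<tau> x y) = \<tau> x (j w y)" for w x y
  proof (rule inner_ext)
    fix z
    have "v_bracket j (\<tau> x y) z + v_bracket j y (\<tau> x z) = 0"
    proof -
      have "(1/2) *\<^sub>R (v_bracket j (\<tau> x y) z + v_bracket j y (\<tau> x z)) = 0"
        using par'[of "(x, 0)" y z] unfolding A_tvv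
        by (simp add: Avv Avz tvv scaleR_add_right)
      then show ?thesis by simp
    qed
    then have "(v_bracket j (\<tau> x y) z + v_bracket j y (\<tau> x z)) \<bullet> w = 0" by simp
    then have "j w (\<tau> x y) \<bullet> z + j w y \<bullet> \<tau> x z = 0"
      by (simp add: inner_add_left v_bracket_inner[OF bil])
    moreover have "\<tau> x (j w y) \<bullet> z + j w y \<bullet> \<tau> x z = 0"
      using t_skew[of "(x, 0)" "(j w y, 0)" "(z, 0)"] by (simp add: tvv)
    ultimately show "j w (\<tau> x y) \<bullet> z = \<tau> x (j w y) \<bullet> z" by simp
  qed
  have "j w (\<tau> x y) = 0" for w x y
  proof (rule commuting_three_form_zero[where L = "j w" and \<tau> = \<tau>, OF _ _ j_skew \<tau>_comm])
    show "\<tau> y x = - \<tau> x y" for x y using t_anti[of "(y, 0)" "(x, 0)"] by (simp add: \<tau>_def)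
    show "\<tau> x y \<bullet> z = - (y \<bullet> \<tau> x z)" for x y z
      using t_skew[of "(x, 0)" "(y, 0)" "(z, 0)"] by (simp add: tvv)
  qed
  \<comment> \<open>\<open>J_op\<close> is a sum of squares of operators that all kill the values of
    \<tau>, yet it is the nonzero multiple \<open>C\<close> of the identity.\<close>
  then have "C *\<^sub>R \<tau> x y = 0" for x y
    using J[of "\<tau> x y"] bilinear_rzero[OF bil] by (simp add: J_op_def)
  then have \<tau>0: "\<tau> x y = 0" for x y using nondegenerate(1)[OF J B CD] by simp
  show "t X Y = (- (1/2) *\<^sub>R j (snd Y) (fst X) + (1/2) *\<^sub>R j (snd X) (fst Y),
             (1/2) *\<^sub>R v_bracket j (fst X) (fst Y) + Tz (snd X) (snd Y))" for X Y
    by (subst split[of X], subst split[of Y], unfold t_simps tvv tvz tzv tzz) (simp add: \<tau>0)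
  show "lie_bracket Tz"
    unfolding lie_bracket_def
  proof (intro conjI allI Tz_bil)
    show "Tz x x = 0" for x using t_alt[of "(0, x)"] by (simp add: Tz_def)
    fix x y z
    \<comment> \<open>Under \<open>j\<close> the expression becomes the Jacobi sum of commutators,
      which vanishes; injectivity of \<open>j\<close> transfers this to \<open>Tz\<close>.\<close>
    have "j (Tz x (Tz y z) + Tz y (Tz z x) + Tz z (Tz x y)) v = 0" for v
      unfolding j_simps hom[symmetric] by (simp add: bilinear_rsub[OF bil])
    then show "Tz x (Tz y z) + Tz y (Tz z x) + Tz z (Tz x y) = 0"
      by (intro nondegenerate(2)[OF J B CD]) auto
  qed
qed

end

section \<open>Curvature of vector fields\<close>

lemma levi_civita_torsion:
  assumes "levi_civita g nab" "smooth X" "smooth Y"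
  shows "nab X Y p - nab Y X p = vf_bracket X Y p"
  using assms by (simp add: levi_civita_def)

lemma levi_civita_metric:
  assumes "levi_civita g nab" "smooth X" "smooth Y" "smooth Z"
  shows "dir_deriv X (\<lambda>q. g q (Y q) (Z q)) p = g p (nab X Y p) (Z p) + g p (Y p) (nab X Z p)"
  using assms unfolding levi_civita_def by blast

lemma tensor21_fieldD:
  assumes "tensor21_field T"
  shows "bilinear (T p)" "smooth (\<lambda>p. T p u w)"
  using assms by (simp_all add: tensor21_field_def)

lemma homogeneous_structureD:
  assumes "homogeneous_structure g nab T"
  shows "tensor21_field T"
    and "\<lbrakk>smooth V; smooth X; smooth Y; smooth Z\<rbrakk> \<Longrightarrow> nabla_curvature nab V X Y Z p =
      tact T V (curvature nab X Y Z) p - curvature nab (tact T V X) Y Z p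
        - curvature nab X (tact T V Y) Z p - curvature nab X Y (tact T V Z) p"
    and "\<lbrakk>smooth X; smooth Y; smooth Z\<rbrakk> \<Longrightarrow> nabla_tensor nab T X Y Z p =
      tact T X (tact T Y Z) p - tact T Y (tact T X Z) p - tact T (tact T X Y) Z p"
    and "\<lbrakk>smooth X; smooth Y; smooth Z\<rbrakk> \<Longrightarrow>
      g p (tact T X Y p) (Z p) + g p (Y p) (tact T X Z p) = 0"
  using assms by (simp_all add: homogeneous_structure_def)

lemma naturally_reductiveD:
  assumes "naturally_reductive g nab T"
  shows "homogeneous_structure g nab T" "smooth X \<Longrightarrow> tact T X X p = 0"
  using assms by (simp_all add: naturally_reductive_def)

text \<open>The difference of two Levi-Civita connections, paired with \<open>Z\<close>, is symmetric in its first
  two and skew in its last two arguments, hence zero.\<close>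

lemma levi_civita_difference_zero:
  assumes "levi_civita g nab" "levi_civita g nab'" "\<And>p. bilinear (g p)" "\<And>p x y. g p x y = g p y x"
    and X: "smooth X" and Y: "smooth Y" and Z: "smooth Z"
  shows "g p (nab X Y p - nab' X Y p) (Z p) = 0"
proof -
  define S where "S X Y Z = g p (nab X Y p - nab' X Y p) (Z p)" for X Y Z
  have sym: "S X Y Z = S Y X Z" if "smooth X" "smooth Y" for X Y Z
  proof -
    have "nab X Y p - nab Y X p = nab' X Y p - nab' Y X p"
      using assms(1,2) that by (simp add: levi_civita_torsion)
    then have "nab X Y p - nab' X Y p = nab Y X p - nab' Y X p"
      by (simp add: algebra_simps)
    then show ?thesis by (simp add: S_def)
  qed
  have skew: "S X Y Z = - S X Z Y" if "smooth X" "smooth Y" "smooth Z" for X Y Z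
  proof -
    have "g p (nab X Y p) (Z p) + g p (Y p) (nab X Z p) = g p (nab' X Y p) (Z p) + g p (Y p) (nab' X Z p)"
      using levi_civita_metric[OF assms(1) that] levi_civita_metric[OF assms(2) that] by simp
    then show ?thesis
      using assms(4)[of p "nab X Z p" "Y p"] assms(4)[of p "nab' X Z p" "Y p"]
      by (simp add: S_def bilinear_lsub[OF assms(3)])
  qed
  show ?thesis
    using sym[OF X Y, of Z] sym[OF Y Z, of X] sym[OF X Z, of Y]
      skew[OF X Y Z] skew[OF Y Z X] skew[OF Z X Y]
    unfolding S_def by linarith
qed

section \<open>The left-invariant frame, and uniqueness of the connection\<close>

context two_step
begin

text \<open>The Maurer-Cartan form: the differential at \<open>p\<close> of left translation by the
  inverse of \<open>p\<close>.\<close>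

definition frame_at :: "'v \<times> 'z \<Rightarrow> 'v \<times> 'z \<Rightarrow> 'v \<times> 'z" where
  "frame_at p u = u - (1/2) *\<^sub>R n_bracket j p u"

lemma frame_coord_at: "frame_coord X p = frame_at p (X p)"
  by (simp add: frame_coord_def frame_at_def)

lemma frame_at_linear: "linear (frame_at p)"
  by (rule linearI) (simp_all add: frame_at_def n_simps algebra_simps)

lemmas frame_at_simps =
  linear_add[OF frame_at_linear] linear_diff[OF frame_at_linear] linear_0[OF frame_at_linear]

lemma frame_at_left_inv_field [simp]: "frame_at p (left_inv_field j x p) = x"
  by (simp add: frame_at_def left_inv_field_eq n_simps n_bracket_two_step)

lemma left_inv_field_frame_at [simp]: "left_inv_field j (frame_at p u) p = u"
  by (simp add: frame_at_def left_inv_field_eq n_simps n_bracket_two_step)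

lemma frame_at_inj: "frame_at p u = frame_at p w \<longleftrightarrow> u = w"
  by (metis left_inv_field_frame_at)

lemma left_inv_metric_frame_at: "left_inv_metric j p u w = frame_at p u \<bullet> frame_at p w"
  by (simp add: left_inv_metric_eq frame_at_def)

lemma smooth_left_inv_field: "smooth (left_inv_field j x)"
  unfolding left_inv_field_eq[abs_def]
  by (intro smooth_add[OF smooth_const smooth_bilin[OF bounded_bilinear_scaleR smooth_const
        smooth_bilin[OF bounded_bilinear_n_bracket smooth_ident smooth_const]]])

lemma left_inv_metric_bilinear: "bilinear (left_inv_metric j p)"
  unfolding bilinear_def left_inv_metric_frame_at[abs_def]
  by (intro conjI allI linearI)
    (simp_all add: frame_at_simps linear_cmul[OF frame_at_linear] inner_add_left inner_add_right)

text \<open>Restricted to smooth fields, since \<open>levi_civita\<close> says nothing about others.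
  Testing against left-invariant fields suffices because they span every tangent space.\<close>

lemma levi_civita_eq_nab0:
  assumes nab: "levi_civita (left_inv_metric j) nab" and X: "smooth X" and Y: "smooth Y"
  shows "nab X Y = nab0 X Y"
proof
  fix p
  have "left_inv_metric j p (nab X Y p - nab0 X Y p) (left_inv_field j z p) = 0" for z
    by (rule levi_civita_difference_zero[OF nab levi_civita_nab0 left_inv_metric_bilinear _ X Y smooth_left_inv_field])
      (simp add: left_inv_metric_frame_at inner_commute)
  then have "frame_at p (nab X Y p - nab0 X Y p) \<bullet> z = 0" for z
    by (simp add: left_inv_metric_frame_at)
  then have "frame_at p (nab X Y p - nab0 X Y p) = 0" by (metis inner_eq_zero_iff)
  then show "nab X Y p = nab0 X Y p" using frame_at_inj[of p "nab X Y p - nab0 X Y p" 0]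
    by (simp add: frame_at_simps)
qed

lemma vf_bracket_nab0:
  assumes "smooth X" "smooth Y"
  shows "vf_bracket X Y p = nab0 X Y p - nab0 Y X p"
  using levi_civita_torsion[OF levi_civita_nab0 assms] by simp

lemma smooth_vf_bracket:
  fixes X Y :: "('v \<times> 'z) vfield"
  assumes "smooth X" "smooth Y" shows "smooth (vf_bracket X Y)"
proof -
  have "vf_bracket X Y = (\<lambda>p. nab0 X Y p - nab0 Y X p)"
    using vf_bracket_nab0[OF assms] by blast
  then show ?thesis using assms by (simp add: smooth_minus smooth_nab0)
qed

lemma smooth_curvature_nab0:
  assumes "smooth X" "smooth Y" "smooth Z" shows "smooth (curvature nab0 X Y Z)"
  unfolding curvature_def[abs_def]
  by (intro smooth_minus smooth_nab0 smooth_vf_bracket assms)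

lemma frame_nab0_nab0:
  assumes X: "smooth X" and Y: "smooth Y" and Z: "smooth Z"
  shows "frame_coord (nab0 X (nab0 Y Z)) p =
    frechet_derivative (\<lambda>q. frechet_derivative (frame_coord Z) (at q) (Y p)) (at p) (X p)
    + frechet_derivative (frame_coord Z) (at p) (frechet_derivative Y (at p) (X p))
    + nab_alg (frame_coord Y p) (frechet_derivative (frame_coord Z) (at p) (X p))
    + nab_alg (frechet_derivative (frame_coord Y) (at p) (X p)) (frame_coord Z p)
    + nab_alg (frame_coord X p) (frechet_derivative (frame_coord Z) (at p) (Y p))
    + nab_alg (frame_coord X p) (nab_alg (frame_coord Y p) (frame_coord Z p))"
proof -
  note s = smooth_frame[OF X] smooth_frame[OF Y] smooth_frame[OF Z]
  have "frame_coord (nab0 Y Z) = (\<lambda>q. frechet_derivative (frame_coord Z) (at q) (Y q)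
      + nab_alg (frame_coord Y q) (frame_coord Z q))"
    using frame_nab0 by blast
  then show ?thesis
    by (simp add: frame_nab0 frechet_add[OF smooth_dir[OF s(3) Y] smooth_bilin[OF bounded_bilinear_nab_alg s(2,3)]]
      frechet_derivative_dir[OF s(3) Y] frechet_derivative_bilinear[OF bounded_bilinear_nab_alg s(2,3)] nab_alg_simps)
qed

text \<open>Tensoriality of the curvature: all derivatives of the components cancel. It is needed
  for general fields because \<open>tact T V X\<close> need not be left-invariant.\<close>

lemma frame_curvature_nab0:
  assumes X: "smooth X" and Y: "smooth Y" and Z: "smooth Z"
  shows "frame_coord (curvature nab0 X Y Z) p = curv_alg (frame_coord X p) (frame_coord Y p) (frame_coord Z p)"
proof -
  note s = smooth_frame[OF X] smooth_frame[OF Y] smooth_frame[OF Z]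
  have b: "frame_coord (vf_bracket X Y) p =
     frechet_derivative (frame_coord Y) (at p) (X p) - frechet_derivative (frame_coord X) (at p) (Y p)
       + n_bracket j (frame_coord X p) (frame_coord Y p)"
    unfolding frame_coord_at[of "vf_bracket X Y"] vf_bracket_nab0[OF X Y] frame_at_simps
    by (simp flip: frame_coord_at nab_alg_torsion add: frame_nab0)
  have "frame_coord (nab0 (vf_bracket X Y) Z) p =
      frechet_derivative (frame_coord Z) (at p) (frechet_derivative Y (at p) (X p))
      - frechet_derivative (frame_coord Z) (at p) (frechet_derivative X (at p) (Y p))
      + nab_alg (frechet_derivative (frame_coord Y) (at p) (X p)) (frame_coord Z p)
      - nab_alg (frechet_derivative (frame_coord X) (at p) (Y p)) (frame_coord Z p)
      + nab_alg (n_bracket j (frame_coord X p) (frame_coord Y p)) (frame_coord Z p)"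
    unfolding frame_nab0 b
    by (simp add: vf_bracket_def dir_deriv_def linear_diff[OF frechet_linear[OF s(3)]] nab_alg_simps
        bilinear_lsub[OF nab_alg_bilinear])
  moreover have "frame_coord (curvature nab0 X Y Z) p =
      frame_coord (nab0 X (nab0 Y Z)) p - frame_coord (nab0 Y (nab0 X Z)) p
        - frame_coord (nab0 (vf_bracket X Y) Z) p"
    by (simp add: frame_coord_at curvature_def frame_at_simps)
  ultimately show ?thesis
    unfolding frame_nab0_nab0[OF X Y Z] frame_nab0_nab0[OF Y X Z] curv_alg_def
      frechet_derivative_commute[OF s(3), of "X p" p "Y p"]
    by simp
qed

end

section \<open>Homogeneous structures in the left-invariant frame\<close>

text \<open>\<open>tensor21_field\<close> provides smoothness for constant arguments only, so both
  arguments are expanded in the basis of the chart.\<close>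

lemma smooth_tact:
  assumes T: "tensor21_field T" and X: "smooth X" and Y: "smooth Y"
  shows "smooth (tact T X Y)"
proof -
  have "T p u w = (\<Sum>b\<in>Basis. \<Sum>c\<in>Basis. (u \<bullet> b) *\<^sub>R (w \<bullet> c) *\<^sub>R T p b c)" for p u w
  proof -
    have l: "linear (\<lambda>u. T p u w)" "linear (T p u)" for u w using tensor21_fieldD(1)[OF T, of p] by (simp_all add: bilinear_def)
    have T_w: "T p b w = (\<Sum>c\<in>Basis. (w \<bullet> c) *\<^sub>R T p b c)" for b
      by (subst euclidean_representation[of w, symmetric])
        (simp only: linear_sum[OF l(2)] linear_cmul[OF l(2)])
    have "T p u w = (\<Sum>b\<in>Basis. (u \<bullet> b) *\<^sub>R T p b w)"
      by (subst euclidean_representation[of u, symmetric])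
        (simp only: linear_sum[OF l(1)] linear_cmul[OF l(1)])
    also have "\<dots> = (\<Sum>b\<in>Basis. \<Sum>c\<in>Basis. (u \<bullet> b) *\<^sub>R (w \<bullet> c) *\<^sub>R T p b c)"
      by (simp only: T_w scaleR_sum_right)
    finally show ?thesis .
  qed
  then have "tact T X Y = (\<lambda>p. \<Sum>b\<in>Basis. \<Sum>c\<in>Basis. (X p \<bullet> b) *\<^sub>R (Y p \<bullet> c) *\<^sub>R T p b c)"
    unfolding tact_def by blast
  moreover have "smooth (\<lambda>p. T p b c)" for b c by (rule tensor21_fieldD[OF T])
  ultimately show ?thesis
    by (simp only:) (intro smooth_sum finite_Basis smooth_bilin[OF bounded_bilinear_scaleR]
        smooth_bilin[OF bounded_bilinear_inner] smooth_const X Y)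
qed

section \<open>Conditions (1) and (2) as algebraic identities for the components\<close>

context two_step
begin

lemma curvature_eq_nab0:
  assumes nab: "levi_civita (left_inv_metric j) nab" and "smooth X" "smooth Y" "smooth Z"
  shows "curvature nab X Y Z = curvature nab0 X Y Z"
  using assms by (auto simp: curvature_def levi_civita_eq_nab0[OF nab] smooth_nab0 smooth_vf_bracket)

lemma homogeneous_structure_nab0:
  assumes nab: "levi_civita (left_inv_metric j) nab"
  shows "homogeneous_structure (left_inv_metric j) nab T \<longleftrightarrow> homogeneous_structure (left_inv_metric j) nab0 T"
proof -
  note [simp] = curvature_eq_nab0[OF nab] levi_civita_eq_nab0[OF nab] smooth_nab0 smooth_curvature_nab0
  have "nabla_curvature nab V X Y Z p = nabla_curvature nab0 V X Y Z p"
    "nabla_tensor nab T X Y Z p = nabla_tensor nab0 T X Y Z p"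
    "curvature nab (tact T V X) Y Z p = curvature nab0 (tact T V X) Y Z p"
    "curvature nab X (tact T V Y) Z p = curvature nab0 X (tact T V Y) Z p"
    "curvature nab X Y (tact T V Z) p = curvature nab0 X Y (tact T V Z) p"
    "tact T V (curvature nab X Y Z) p = tact T V (curvature nab0 X Y Z) p"
    if "smooth V" "smooth X" "smooth Y" "smooth Z" "tensor21_field T" for V X Y Z p
    using that by (simp_all add: nabla_curvature_def nabla_tensor_def smooth_tact)
  then show ?thesis
    unfolding homogeneous_structure_def by (simp cong: conj_cong imp_cong)
qed

text \<open>The point remains a parameter since \<open>T\<close> is not assumed to be
  left-invariant.\<close>

definition frame_tensor ::
  "('v \<times> 'z) tensor21 \<Rightarrow> 'v \<times> 'z \<Rightarrow> 'v \<times> 'z \<Rightarrow> 'v \<times> 'z \<Rightarrow> 'v \<times> 'z" where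
  "frame_tensor T p x y = frame_at p (T p (left_inv_field j x p) (left_inv_field j y p))"

lemma frame_tact: "frame_at p (tact T X Y p) = frame_tensor T p (frame_coord X p) (frame_coord Y p)"
  by (simp add: frame_tensor_def tact_def frame_coord_at)

lemma frame_coord_tact:
  "frame_coord (tact T X Y) p = frame_tensor T p (frame_coord X p) (frame_coord Y p)"
  by (simp add: frame_coord_at[of "tact T X Y"] frame_tact)

lemma frame_coord_left_inv_field [simp]: "frame_coord (left_inv_field j x) p = x"
  by (simp add: frame_coord_at)

lemma bilinear_frame_tensor:
  assumes "tensor21_field T"
  shows "bilinear (frame_tensor T p)"
proof -
  have b: "bilinear (T p)" by (rule tensor21_fieldD[OF assms])
  show ?thesis
    unfolding bilinear_def frame_tensor_def
    by (intro conjI allI linearI)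
      (simp_all only: frame_at_simps linear_cmul[OF frame_at_linear] linear_add[OF left_inv_field_linear]
        linear_cmul[OF left_inv_field_linear] bilinear_ladd[OF b] bilinear_radd[OF b]
        bilinear_lmul[OF b] bilinear_rmul[OF b])
qed

text \<open>Condition (1) on left-invariant fields: the components of these fields and of their
  curvature are constant, so every derivative term drops out.\<close>

lemma frame_tensor_derivation_curv_alg:
  assumes T: "homogeneous_structure (left_inv_metric j) nab0 T"
  defines "A \<equiv> \<lambda>p x y. frame_tensor T p x y - nab_alg x y"
  shows "A p v (curv_alg x y z) =
    curv_alg (A p v x) y z + curv_alg x (A p v y) z + curv_alg x y (A p v z)"
proof -
  let ?E = "left_inv_field j"
  note T' = homogeneous_structureD(1)[OF T]
  note [simp] = smooth_left_inv_field smooth_nab0 smooth_tact[OF T'] frame_curvature_nab0 frame_nab0 frame_coord_tact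
  have const: "frame_coord (?E x) = (\<lambda>q. x)" for x by (rule ext) simp
  have constR: "frame_coord (curvature nab0 (?E x) (?E y) (?E z)) = (\<lambda>q. curv_alg x y z)"
    by (rule ext) simp
  have e: "nabla_curvature nab0 (?E v) (?E x) (?E y) (?E z) p =
      tact T (?E v) (curvature nab0 (?E x) (?E y) (?E z)) p
      - curvature nab0 (tact T (?E v) (?E x)) (?E y) (?E z) p
      - curvature nab0 (?E x) (tact T (?E v) (?E y)) (?E z) p
      - curvature nab0 (?E x) (?E y) (tact T (?E v) (?E z)) p"
    by (rule homogeneous_structureD[OF T]) simp_all
  let ?t = "frame_tensor T p"
  have "nab_alg v (curv_alg x y z) - curv_alg (nab_alg v x) y z - curv_alg x (nab_alg v y) z
      - curv_alg x y (nab_alg v z) =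
     ?t v (curv_alg x y z) - curv_alg (?t v x) y z - curv_alg x (?t v y) z - curv_alg x y (?t v z)"
    using arg_cong[OF e, of "frame_at p"]
    unfolding nabla_curvature_def frame_at_simps frame_tact frame_coord_at[symmetric]
    by (simp add: const constR)
  then show ?thesis
    by (simp add: A_def linear_diff[OF curv_alg_linear(1)] linear_diff[OF curv_alg_linear(2)]
        linear_diff[OF curv_alg_linear(3)] algebra_simps)
qed

text \<open>Condition (2) solved for its derivative term. Wherever a component of the tensor is
  constant, the right-hand side vanishes there, which is a derivation property of
  \<open>A\<close>.\<close>

lemma frame_tensor_derivative:
  assumes T: "homogeneous_structure (left_inv_metric j) nab0 T"
  defines "A \<equiv> \<lambda>p x y. frame_tensor T p x y - nab_alg x y"
  shows "((\<lambda>q. frame_tensor T q y z) has_derivative (\<lambda>h. frechet_derivative (\<lambda>q. frame_tensor T q y z) (at p) h)) (at p)"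
    and "frechet_derivative (\<lambda>q. frame_tensor T q y z) (at p) (left_inv_field j x p) =
    A p x (frame_tensor T p y z) - frame_tensor T p (A p x y) z - frame_tensor T p y (A p x z)"
proof -
  let ?E = "left_inv_field j"
  note T' = homogeneous_structureD(1)[OF T]
  have const: "frame_coord (?E x) = (\<lambda>q. x)" for x by (rule ext) simp
  have constT: "frame_coord (tact T (?E y) (?E z)) = (\<lambda>q. frame_tensor T q y z)"
    by (rule ext) (simp add: frame_coord_at frame_tact)
  have "smooth (\<lambda>q. frame_tensor T q y z)"
    unfolding constT[symmetric] by (intro smooth_frame smooth_tact T' smooth_left_inv_field)
  then show "((\<lambda>q. frame_tensor T q y z) has_derivative (\<lambda>h. frechet_derivative (\<lambda>q. frame_tensor T q y z) (at p) h)) (at p)"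
    by (rule smooth_has_derivative)
  have e: "nabla_tensor nab0 T (?E x) (?E y) (?E z) p =
      tact T (?E x) (tact T (?E y) (?E z)) p - tact T (?E y) (tact T (?E x) (?E z)) p
      - tact T (tact T (?E x) (?E y)) (?E z) p"
    by (rule homogeneous_structureD[OF T]; rule smooth_left_inv_field)
  let ?t = "frame_tensor T p"
  have "frechet_derivative (\<lambda>q. frame_tensor T q y z) (at p) (?E x p) + nab_alg x (?t y z)
      - ?t (nab_alg x y) z - ?t y (nab_alg x z) = ?t x (?t y z) - ?t y (?t x z) - ?t (?t x y) z"
    using arg_cong[OF e, of "frame_at p"]
    unfolding nabla_tensor_def frame_at_simps frame_tact
    unfolding frame_coord_at[symmetric] frame_nab0 constT const
    by (simp add: frame_coord_at frame_tact frechet_derivative_const)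
  then show "frechet_derivative (\<lambda>q. frame_tensor T q y z) (at p) (?E x p) =
    A p x (?t y z) - ?t (A p x y) z - ?t y (A p x z)"
    by (simp add: A_def bilinear_lsub[OF bilinear_frame_tensor[OF T']]
        bilinear_rsub[OF bilinear_frame_tensor[OF T']] algebra_simps)
qed

lemma naturally_reductive_frame_tensor:
  assumes J: "\<And>x. J_op j x = C *\<^sub>R x" and B: "\<And>z. B_op j z = D *\<^sub>R z" and CD: "D \<noteq> 2 * C"
    and nab: "levi_civita (left_inv_metric j) nab"
    and T: "naturally_reductive (left_inv_metric j) nab T"
  defines "Tz \<equiv> \<lambda>p x y. snd (frame_tensor T p (0, x) (0, y))"
  shows "lie_bracket (Tz p)" "Tz p z \<in> so"
    "j x (j y v) - j y (j x v) = j (Tz p x y) v"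
    "frame_tensor T p X Y = (- (1/2) *\<^sub>R j (snd Y) (fst X) + (1/2) *\<^sub>R j (snd X) (fst Y),
       (1/2) *\<^sub>R v_bracket j (fst X) (fst Y) + Tz p (snd X) (snd Y))"
proof -
  let ?E = "left_inv_field j" and ?t = "frame_tensor T"
  define A where "A p x y = ?t p x y - nab_alg x y" for p x y
  have hs: "homogeneous_structure (left_inv_metric j) nab0 T"
    using naturally_reductiveD(1)[OF T] homogeneous_structure_nab0[OF nab] by simp
  note T' = homogeneous_structureD(1)[OF hs]
  have alt: "?t p x x = 0" for p x
  proof -
    have "tact T (?E x) (?E x) p = 0"
      by (rule naturally_reductiveD(2)[OF T smooth_left_inv_field])
    then show ?thesis using frame_tact[of p T "?E x" "?E x"] by (simp add: frame_at_simps)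
  qed
  have skew: "?t p x y \<bullet> z + y \<bullet> ?t p x z = 0" for p x y z
  proof -
    have "left_inv_metric j p (tact T (?E x) (?E y) p) (?E z p)
        + left_inv_metric j p (?E y p) (tact T (?E x) (?E z) p) = 0"
      by (rule homogeneous_structureD(4)[OF hs]; rule smooth_left_inv_field)
    then show ?thesis by (simp add: left_inv_metric_frame_at frame_tact)
  qed
  have der: "A p v (curv_alg x y z) =
      curv_alg (A p v x) y z + curv_alg x (A p v y) z + curv_alg x y (A p v z)" for p v x y z
    unfolding A_def by (rule frame_tensor_derivation_curv_alg[OF hs])
  have vv: "snd (?t p (y, 0) (z, 0)) = (1/2) *\<^sub>R v_bracket j y z" for p y z
  proof -
    have "A p v x \<bullet> y + x \<bullet> A p v y = 0" for v x y
      using skew[of p v x y] nab_alg_skew[of v x y]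
      by (simp add: A_def inner_diff_left inner_diff_right)
    from derivation_preserves_factors(1)[where A = "A p (y, 0)", OF J B CD this der]
    have "snd (A p (y, 0) (z, 0)) = 0" .
    then show ?thesis by (simp add: A_def nab_alg_def)
  qed
  \<comment> \<open>By \<open>vv\<close> the z-component on pairs from v is the same at all points,
    so its derivative is zero.\<close>
  have par: "snd (A p x (?t p (y, 0) (z, 0)) - ?t p (A p x (y, 0)) (z, 0) - ?t p (y, 0) (A p x (z, 0))) = 0"
    for p x y z
  proof -
    let ?D = "frechet_derivative (\<lambda>q. ?t q (y, 0) (z, 0)) (at p)"
    have "((\<lambda>q. snd (?t q (y, 0) (z, 0))) has_derivative (\<lambda>h. snd (?D h))) (at p)"
      by (rule has_derivative_snd[OF frame_tensor_derivative(1)[OF hs]])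
    then have "(\<lambda>h. snd (?D h)) = (\<lambda>h. 0)"
      unfolding vv by (rule has_derivative_unique) (rule has_derivative_const)
    then have "snd (?D (?E x p)) = 0" by meson
    then show ?thesis unfolding A_def frame_tensor_derivative(2)[OF hs] .
  qed
  note form = structure_tensor_form[OF J B CD bilinear_frame_tensor[OF T', of p] alt skew A_def der par]
  show "lie_bracket (Tz p)" "Tz p z \<in> so" "j x (j y v) - j y (j x v) = j (Tz p x y) v"
    "frame_tensor T p X Y = (- (1/2) *\<^sub>R j (snd Y) (fst X) + (1/2) *\<^sub>R j (snd X) (fst Y),
       (1/2) *\<^sub>R v_bracket j (fst X) (fst Y) + Tz p (snd X) (snd Y))"
    unfolding Tz_def by (rule form)+
qed

end

section \<open>Uniqueness and left-invariance of the structure\<close>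

theorem theorem1p7:
  fixes j :: "'z::euclidean_space \<Rightarrow> 'v::euclidean_space \<Rightarrow> 'v"
    and C D :: real
    and nab :: "('v \<times> 'z) vfield \<Rightarrow> ('v \<times> 'z) vfield \<Rightarrow> ('v \<times> 'z) vfield"
    and T :: "('v \<times> 'z) tensor21"
  assumes "bilinear j" and "\<forall>z. j z \<in> so"
    and "\<forall>x. J_op j x = C *\<^sub>R x"
    and "\<forall>z. B_op j z = D *\<^sub>R z"
    and "D \<noteq> 2 * C"
    and "levi_civita (left_inv_metric j) nab"
    and "naturally_reductive (left_inv_metric j) nab T"
  shows "(\<forall>T'. naturally_reductive (left_inv_metric j) nab T' \<longrightarrow> T' = T) \<and>
    (\<exists>Tz :: 'z \<Rightarrow> 'z \<Rightarrow> 'z.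
       lie_bracket Tz \<and>
       (\<forall>z. Tz z \<in> so) \<and>
       (\<forall>x y v. j x (j y v) - j y (j x v) = j (Tz x y) v) \<and>
       (\<forall>X Y. tact T (left_inv_field j X) (left_inv_field j Y) =
          left_inv_field j
            (- (1/2) *\<^sub>R j (snd Y) (fst X) + (1/2) *\<^sub>R j (snd X) (fst Y),
             (1/2) *\<^sub>R v_bracket j (fst X) (fst Y) + Tz (snd X) (snd Y))))"
proof -
  interpret two_step j using assms(1,2) by unfold_locales auto
  have J: "J_op j x = C *\<^sub>R x" for x using assms(3) by blast
  have B: "B_op j z = D *\<^sub>R z" for z using assms(4) by blast
  note CD = assms(5) and nab = assms(6) and nr = assms(7)
  note form = naturally_reductive_frame_tensor[OF J B CD nab]
  define Tz where "Tz S p x y = snd (frame_tensor S p (0, x) (0, y))" for S p x y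
  \<comment> \<open>\<open>j\<close> sends each such value to the commutator of \<open>j x\<close>
    and \<open>j y\<close>, which involves neither the structure nor the point. Injectivity thus
    gives uniqueness and constancy at once; the point 0 is an arbitrary reference.\<close>
  have same_Tz: "Tz S p x y = Tz T 0 x y" if S: "naturally_reductive (left_inv_metric j) nab S" for S p x y
  proof -
    have "j (Tz S p x y - Tz T 0 x y) = (\<lambda>v. 0)"
      using form(3)[OF S, of x y _ p] form(3)[OF nr, of x y _ 0]
      by (auto simp: Tz_def bilinear_lsub[OF bil])
    then have "Tz S p x y - Tz T 0 x y = 0" by (rule nondegenerate(2)[OF J B CD])
    then show ?thesis by simp
  qed
  have frame: "frame_tensor S p X Y = (- (1/2) *\<^sub>R j (snd Y) (fst X) + (1/2) *\<^sub>R j (snd X) (fst Y),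
       (1/2) *\<^sub>R v_bracket j (fst X) (fst Y) + Tz T 0 (snd X) (snd Y))"
    if S: "naturally_reductive (left_inv_metric j) nab S" for S p X Y
    using form(4)[OF S, of p X Y] same_Tz[OF S, of p] by (simp add: Tz_def)
  \<comment> \<open>Every tangent vector is recovered from its frame components, so equal components
    give equal tensors.\<close>
  have unique: "S = T" if S: "naturally_reductive (left_inv_metric j) nab S" for S
  proof (intro ext)
    fix p u w
    have "frame_tensor S p (frame_at p u) (frame_at p w) = frame_tensor T p (frame_at p u) (frame_at p w)"
      unfolding frame[OF S] frame[OF nr] ..
    then show "S p u w = T p u w" by (simp add: frame_tensor_def frame_at_inj)
  qed
  have "tact T (left_inv_field j X) (left_inv_field j Y) p =
      left_inv_field j
        (- (1/2) *\<^sub>R j (snd Y) (fst X) + (1/2) *\<^sub>R j (snd X) (fst Y),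
         (1/2) *\<^sub>R v_bracket j (fst X) (fst Y) + Tz T 0 (snd X) (snd Y)) p" for X Y p
    by (rule iffD1[OF frame_at_inj[of p]]) (simp add: frame_tact frame[OF nr])
  then have "tact T (left_inv_field j X) (left_inv_field j Y) =
      left_inv_field j
        (- (1/2) *\<^sub>R j (snd Y) (fst X) + (1/2) *\<^sub>R j (snd X) (fst Y),
         (1/2) *\<^sub>R v_bracket j (fst X) (fst Y) + Tz T 0 (snd X) (snd Y))" for X Y
    by (rule ext)
  moreover have "lie_bracket (Tz T 0)" "Tz T 0 z \<in> so" "j x (j y v) - j y (j x v) = j (Tz T 0 x y) v" for x y z v
    using form(1-3)[OF nr, where p = 0] by (simp_all add: Tz_def[abs_def])
  ultimately show ?thesis using unique by (intro conjI exI[of _ "Tz T 0"]) auto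
qed

end
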